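(* Let $N\ge1$, $0<s<1$, let $\Omega\subset\mathbb{R}^N$ be a bounded domain with Lipschitz continuous boundary, and let $\kappa\in L^1(\mathbb{R}^N\setminus\Omega)\cap L^\infty(\mathbb{R}^N\setminus\Omega)$ be non-negative. Let $\mu$ be the measure $d\mu=\kappa\,dx$ on $\mathbb{R}^N\setminus\Omega$. Then for every $z\in L^2(\mathbb{R}^N\setminus\Omega,\mu)$ and every $f\in(W^{s,2}_{\Omega,\kappa})^\star$ there exists a weak solution $u\in W^{s,2}_{\Omega,\kappa}$ of the Robin exterior value problem $$(-\Delta)^su=f\ \text{ in }\Omega,\qquad \mathcal{N}_su+\kappa u=\kappa z\ \text{ in }\mathbb{R}^N\setminus\Omega.$$
   Context: $C_{N,s}:=\frac{s2^{2s}\Gamma\left(\frac{2s+N}{2}\right)}{\pi^{N/2}\Gamma(1-s)}$; $(-\Delta)^su(x)=C_{N,s}\,\mathrm{P.V.}\int_{\mathbb{R}^N}\frac{u(x)-u(y)}{|x-y|^{N+2s}}dy$; $\mathcal{N}_su(x)=C_{N,s}\int_\Omega\frac{u(x)-u(y)}{|x-y|^{N+2s}}dy$ for $x\in\mathbb{R}^N\setminus\overline\Omega$. $\mathbb{R}^{2N}\setminus(\mathbb{R}^N\setminus\Omega)^2:=(\Omega\times\Omega)\cup(\Omega\times(\mathbb{R}^N\setminus\Omega))\cup((\mathbb{R}^N\setminus\Omega)\times\Omega)$. $W^{s,2}_{\Omega,\kappa}$ is the Hilbert space of measurable $u:\mathbb{R}^N\to\mathbb{R}$ with finite norm $$\|u\|_{W^{s,2}_{\Omega,\kappa}}=\left(\|u\|^2_{L^2(\Omega)}+\|u\|^2_{L^2(\mathbb{R}^N\setminus\Omega,\mu)}+\iint_{\mathbb{R}^{2N}\setminus(\mathbb{R}^N\setminus\Omega)^2}\frac{|u(x)-u(y)|^2}{|x-y|^{N+2s}}dxdy\right)^{1/2},$$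 and $(W^{s,2}_{\Omega,\kappa})^\star$ is its dual, with pairing $\langle\cdot,\cdot\rangle$. A weak solution of the Robin problem is $u\in W^{s,2}_{\Omega,\kappa}$ such that for every $v\in W^{s,2}_{\Omega,\kappa}$ $$\frac{C_{N,s}}{2}\iint_{\mathbb{R}^{2N}\setminus(\mathbb{R}^N\setminus\Omega)^2}\frac{(u(x)-u(y))(v(x)-v(y))}{|x-y|^{N+2s}}dxdy+\int_{\mathbb{R}^N\setminus\Omega}\kappa uv\,dx=\langle f,v\rangle+\int_{\mathbb{R}^N\setminus\Omega}\kappa zv\,dx.$$
   Formalization: If κ = 0 almost everywhere outside Ω, the formal theorem also requires ⟨f,1⟩ = 0; without this the claim fails (κ = 0, f(v) = ∫_Ω v, tested with v = 1, gives 0 = |Ω|). For κ not a.e. zero nothing is added. *)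

theory Defs
  imports "HOL-Analysis.Analysis"
begin

text \<open>
  \<open>\<real>\<^sup>N\<close> is a type \<open>'a::euclidean_space\<close> with \<open>N = DIM('a)\<close>. Measurability and integration refer
  to Lebesgue measure. Elements of function spaces are represented by functions (not by
  classes modulo null sets), and only the values of \<open>\<kappa>\<close> and \<open>z\<close> outside \<open>\<Omega>\<close> are ever used.
\<close>

text \<open>After a rotation, \<open>\<Omega>\<close> lies near each boundary point strictly above the graph of a
  Lipschitz function on a hyperplane through the origin.\<close>

definition lipschitz_boundary :: "'a::euclidean_space set \<Rightarrow> bool" where
  "lipschitz_boundary \<Omega> \<longleftrightarrow>
     (\<forall>p\<in>frontier \<Omega>. \<exists>r>0. \<exists>e. \<exists>L. \<exists>\<phi>::'a \<Rightarrow> real.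
        norm e = 1 \<and> L-lipschitz_on {y. y \<bullet> e = 0} \<phi> \<and>
        \<Omega> \<inter> ball p r = {x \<in> ball p r. \<phi> (x - (x \<bullet> e) *\<^sub>R e) < x \<bullet> e})"

definition bounded_lipschitz_domain :: "'a::euclidean_space set \<Rightarrow> bool" where
  "bounded_lipschitz_domain \<Omega> \<longleftrightarrow>
     open \<Omega> \<and> connected \<Omega> \<and> \<Omega> \<noteq> {} \<and> bounded \<Omega> \<and> lipschitz_boundary \<Omega>"

definition C_const :: "nat \<Rightarrow> real \<Rightarrow> real" where
  "C_const N s =
     s * 2 powr (2 * s) * Gamma ((2 * s + real N) / 2) / (pi powr (real N / 2) * Gamma (1 - s))"

definition interaction_region :: "'a set \<Rightarrow> ('a \<times> 'a) set" where
  "interaction_region \<Omega> = \<Omega> \<times> \<Omega> \<union> \<Omega> \<times> (- \<Omega>) \<union> (- \<Omega>) \<times> \<Omega>"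

definition exterior_measure :: "'a::euclidean_space set \<Rightarrow> ('a \<Rightarrow> real) \<Rightarrow> 'a measure" where
  "exterior_measure \<Omega> \<kappa> = density (lebesgue_on (- \<Omega>)) (\<lambda>x. ennreal (\<kappa> x))"

definition in_L2 :: "'a measure \<Rightarrow> ('a \<Rightarrow> real) \<Rightarrow> bool" where
  "in_L2 M g \<longleftrightarrow> g \<in> borel_measurable M \<and> (\<integral>\<^sup>+ x. ennreal ((g x)\<^sup>2) \<partial>M) < \<infinity>"

definition W_sqnorm ::
  "real \<Rightarrow> 'a::euclidean_space set \<Rightarrow> ('a \<Rightarrow> real) \<Rightarrow> ('a \<Rightarrow> real) \<Rightarrow> ennreal" where
  "W_sqnorm s \<Omega> \<kappa> u =
     (\<integral>\<^sup>+ x. ennreal ((u x)\<^sup>2) \<partial>lebesgue_on \<Omega>)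
   + (\<integral>\<^sup>+ x. ennreal ((u x)\<^sup>2) \<partial>exterior_measure \<Omega> \<kappa>)
   + (\<integral>\<^sup>+ (x, y)\<in>interaction_region \<Omega>.
        ennreal ((u x - u y)\<^sup>2 / norm (x - y) powr (real DIM('a) + 2 * s))
        \<partial>(lebesgue \<Otimes>\<^sub>M lebesgue))"

definition W_space ::
  "real \<Rightarrow> 'a::euclidean_space set \<Rightarrow> ('a \<Rightarrow> real) \<Rightarrow> ('a \<Rightarrow> real) set" where
  "W_space s \<Omega> \<kappa> = {u \<in> borel_measurable lebesgue. W_sqnorm s \<Omega> \<kappa> u < \<infinity>}"

definition W_norm ::
  "real \<Rightarrow> 'a::euclidean_space set \<Rightarrow> ('a \<Rightarrow> real) \<Rightarrow> ('a \<Rightarrow> real) \<Rightarrow> real" where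
  "W_norm s \<Omega> \<kappa> u = sqrt (enn2real (W_sqnorm s \<Omega> \<kappa> u))"

text \<open>Boundedness forces a functional to agree on functions that differ by a function of
  norm zero, so these are the bounded linear functionals on the space of classes. Values
  outside \<open>W_space\<close> are irrelevant.\<close>

definition W_dual ::
  "real \<Rightarrow> 'a::euclidean_space set \<Rightarrow> ('a \<Rightarrow> real) \<Rightarrow> (('a \<Rightarrow> real) \<Rightarrow> real) set" where
  "W_dual s \<Omega> \<kappa> = {f.
     (\<forall>u\<in>W_space s \<Omega> \<kappa>. \<forall>v\<in>W_space s \<Omega> \<kappa>. f (\<lambda>x. u x + v x) = f u + f v) \<and>
     (\<forall>c. \<forall>u\<in>W_space s \<Omega> \<kappa>. f (\<lambda>x. c * u x) = c * f u) \<and>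
     (\<exists>C. \<forall>u\<in>W_space s \<Omega> \<kappa>. \<bar>f u\<bar> \<le> C * W_norm s \<Omega> \<kappa> u)}"

text \<open>Weak formulation of \<open>(-\<Delta>)\<^sup>s u = f\<close> in \<open>\<Omega>\<close>, \<open>\<N>\<^sub>s u + \<kappa> u = \<kappa> z\<close> outside \<open>\<Omega>\<close>,
  with \<open>\<N>\<^sub>s\<close> the nonlocal normal derivative. If \<open>\<kappa>\<close> vanishes almost everywhere outside \<open>\<Omega>\<close>, this is
  a pure Neumann problem, and testing with \<open>v = 1\<close> shows that \<open>f (\<lambda>x. 1) = 0\<close> is necessary for
  solvability; an existence theorem has to require it in that degenerate case.\<close>

definition robin_weak_solution ::
  "real \<Rightarrow> 'a::euclidean_space set \<Rightarrow> ('a \<Rightarrow> real) \<Rightarrow> (('a \<Rightarrow> real) \<Rightarrow> real) \<Rightarrow> ('a \<Rightarrow> real)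
    \<Rightarrow> ('a \<Rightarrow> real) \<Rightarrow> bool" where
  "robin_weak_solution s \<Omega> \<kappa> f z u \<longleftrightarrow>
     u \<in> W_space s \<Omega> \<kappa> \<and>
     (\<forall>v\<in>W_space s \<Omega> \<kappa>.
        C_const DIM('a) s / 2 *
          (LINT (x, y):interaction_region \<Omega>|(lebesgue \<Otimes>\<^sub>M lebesgue).
             (u x - u y) * (v x - v y) / norm (x - y) powr (real DIM('a) + 2 * s))
        + (LINT x|lebesgue_on (- \<Omega>). \<kappa> x * u x * v x)
        = f v + (LINT x|lebesgue_on (- \<Omega>). \<kappa> x * z x * v x))"

end

theory Submission
  imports Defs
begin

text \<open>
  Write \<open>E u\<close> for the double integral of \<open>(u x - u y)\<^sup>2 / \<bar>x - y\<bar>\<^sup>N\<^sup>+\<^sup>2\<^sup>s\<close> over the interaction region, and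
  \<open>Q u = E u + \<integral> \<kappa> u\<^sup>2\<close> for the energy of the Robin problem. A weak solution is a critical point,
  hence a minimizer, of the quadratic functional \<open>J v = a v v - 2 F v\<close>, where \<open>a\<close> is the bilinear
  form of the problem, so that \<open>a v v\<close> is comparable to \<open>Q v\<close>, and \<open>F v = f v + \<integral> \<kappa> z v\<close>. The
  proof minimizes \<open>J\<close> directly: the parallelogram identity makes minimizing sequences Cauchy for
  \<open>a\<close>, so a minimizer exists once \<open>J\<close> is bounded below and \<open>a\<close>-Cauchy sequences have
  \<open>a\<close>-limits (\<open>quadratic_functional_minimizer\<close>).

  The form \<open>a\<close> controls the norm of the space only through a Poincare inequality, and this holds
  for an elementary reason. On a bounded set the singular kernel is bounded \<^emph>\<open>below\<close>, so for bounded
  \<open>A\<close> and \<open>B\<close> with \<open>A \<times> B\<close> inside the interaction region, the energy dominates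
  \<open>\<integral>\<^sub>B \<integral>\<^sub>A (u x - u y)\<^sup>2 dx dy\<close> (\<open>increments_le_energy\<close>), and an \<open>L\<^sup>2\<close> bound passes from \<open>A\<close> to
  \<open>B\<close> (\<open>L2_transfer\<close>). There are three consequences. If \<open>\<kappa>\<close> is
  not almost everywhere zero, it is bounded below by a positive constant on a bounded exterior set
  of positive measure, and the transfer from there gives
  \<open>\<integral>\<^sub>\<Omega> u\<^sup>2 \<le> K Q u\<close> (\<open>poincare_robin\<close>). If \<open>\<kappa>\<close> vanishes almost everywhere, the choice
  \<open>A = B = \<Omega>\<close> gives \<open>\<integral>\<^sub>\<Omega> (u - c)\<^sup>2 \<le> K Q u\<close> for some constant \<open>c\<close> (\<open>poincare_neumann\<close>).
  Finally the transfer from \<open>\<Omega>\<close> to a ball bounds \<open>u\<close> in \<open>L\<^sup>2\<close> of every ball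
  (\<open>L2_local_control\<close>).

  The two cases are treated together through the constants \<open>c\<close> with \<open>\<kappa> c = 0\<close> almost everywhere
  (\<open>null_constant\<close>): they have zero energy, \<open>f\<close> vanishes on them by the compatibility condition,
  and every \<open>u\<close> is close to one of them on \<open>\<Omega>\<close> in terms of its energy (\<open>poincare\<close>). Subtracting
  them shows that \<open>\<bar>f v\<bar>\<close> is at most a multiple of \<open>sqrt (Q v)\<close> (\<open>dual_energy_bound\<close>), so that \<open>J\<close> is
  bounded below. Subtracting them also turns a rapidly Cauchy sequence for the energy into one that
  is rapidly Cauchy in \<open>L\<^sup>2\<close> of every ball, thus almost everywhere convergent on the whole of \<open>\<real>\<^sup>N\<close>,
  and Fatou's lemma identifies the pointwise limit as a limit in energy (\<open>robin_energy_complete\<close>).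
\<close>

section \<open>Minimizing a quadratic functional\<close>

text \<open>A variational form of the Riesz representation theorem. The form may be degenerate, so only
  completeness up to functions of zero energy is available, and it is required only for sequences
  that are Cauchy at a fixed geometric rate; a minimizing sequence can be chosen to be such. The
  lower bound takes the place of continuity of \<open>F\<close>: applied to all multiples of \<open>v\<close>, it bounds
  \<open>\<bar>F v\<bar>\<close> by a multiple of \<open>sqrt (a v v)\<close>.\<close>

lemma quadratic_functional_minimizer:
  fixes W :: "('b \<Rightarrow> real) set" and a :: "('b \<Rightarrow> real) \<Rightarrow> ('b \<Rightarrow> real) \<Rightarrow> real"
    and F :: "('b \<Rightarrow> real) \<Rightarrow> real"
  assumes ne: "W \<noteq> {}"
    and comb: "\<And>u v t. u \<in> W \<Longrightarrow> v \<in> W \<Longrightarrow> (\<lambda>x. u x + t * v x) \<in> W"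
    and sym: "\<And>u v. u \<in> W \<Longrightarrow> v \<in> W \<Longrightarrow> a u v = a v u"
    and lin_a: "\<And>u v w t. u \<in> W \<Longrightarrow> v \<in> W \<Longrightarrow> w \<in> W \<Longrightarrow>
        a (\<lambda>x. u x + t * v x) w = a u w + t * a v w"
    and lin_F: "\<And>u v t. u \<in> W \<Longrightarrow> v \<in> W \<Longrightarrow> F (\<lambda>x. u x + t * v x) = F u + t * F v"
    and below: "\<And>v. v \<in> W \<Longrightarrow> - B \<le> a v v - 2 * F v"
    and complete: "\<And>v. (\<And>n. v n \<in> W) \<Longrightarrow>
        (\<And>n m. n \<le> m \<Longrightarrow> a (\<lambda>x. v m x - v n x) (\<lambda>x. v m x - v n x) \<le> (1/4) ^ n) \<Longrightarrow>
        \<exists>u\<in>W. (\<lambda>n. a (\<lambda>x. u x - v n x) (\<lambda>x. u x - v n x)) \<longlonglongrightarrow> 0"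
  shows "\<exists>u\<in>W. \<forall>w\<in>W. a u w = F w"
proof -
  define J where "J v = a v v - 2 * F v" for v
  define I where "I = (INF v\<in>W. J v)"
  have expand: "J (\<lambda>x. u x + t * w x) = J u + 2 * t * (a u w - F w) + t\<^sup>2 * a w w"
    if "u \<in> W" "w \<in> W" for u w t
  proof -
    have "a (\<lambda>x. u x + t * w x) (\<lambda>x. u x + t * w x)
        = a u (\<lambda>x. u x + t * w x) + t * a w (\<lambda>x. u x + t * w x)"
      using that by (intro lin_a comb)
    also have "a u (\<lambda>x. u x + t * w x) = a u u + t * a u w"
      using that by (subst sym) (auto intro: comb simp: lin_a sym)
    also have "a w (\<lambda>x. u x + t * w x) = a u w + t * a w w"
      using that by (subst sym) (auto intro: comb simp: lin_a)
    finally show ?thesis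
      using that by (simp add: J_def lin_F algebra_simps power2_eq_square)
  qed
  have bdd: "bdd_below (J ` W)"
    unfolding bdd_below_def using below by (force simp: J_def)
  have I_le: "I \<le> J v" if "v \<in> W" for v
    unfolding I_def using bdd that by (rule cINF_lower)
  have "\<exists>v\<in>W. J v < I + (1/4) ^ n / 4" for n :: nat
    using cINF_less_iff[OF ne bdd, of "I + (1/4)^n / 4"] by (simp add: I_def)
  then obtain v where vW: "\<And>n. v n \<in> W" and vJ: "\<And>n::nat. J (v n) < I + (1/4) ^ n / 4"
    by metis
  have diffW: "(\<lambda>x. u x - w x) \<in> W" if "u \<in> W" "w \<in> W" for u w
    using comb[OF that, of "-1"] by simp
  have "a (\<lambda>x. v m x - v n x) (\<lambda>x. v m x - v n x) \<le> (1/4) ^ n" if "n \<le> m" for n m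
  proof -
    let ?d = "\<lambda>x. v m x - v n x"
    have d: "?d \<in> W" using diffW vW by blast
    \<comment> \<open>Parallelogram identity: the midpoint of two near-minimizers cannot beat the infimum.\<close>
    have "J (\<lambda>x. v n x + 1 * ?d x) = J (v n) + 2 * 1 * (a (v n) ?d - F ?d) + 1\<^sup>2 * a ?d ?d"
      by (rule expand[OF vW d])
    then have e1: "J (v m) = J (v n) + 2 * (a (v n) ?d - F ?d) + a ?d ?d" by simp
    have "I \<le> J (\<lambda>x. v n x + (1/2) * ?d x)"
      by (intro I_le comb vW d)
    also have "\<dots> = J (v n) + 2 * (1/2) * (a (v n) ?d - F ?d) + (1/2)\<^sup>2 * a ?d ?d"
      by (rule expand[OF vW d])
    finally have "2 * I \<le> J (v n) + J (v m) - a ?d ?d / 2"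
      using e1 by (simp add: power2_eq_square)
    then have "a ?d ?d \<le> (1/4) ^ n / 2 + (1/4) ^ m / 2"
      using vJ[of n] vJ[of m] by simp
    moreover have "(1/4::real) ^ m \<le> (1/4) ^ n"
      using that by (intro power_decreasing) auto
    ultimately show ?thesis by linarith
  qed
  with complete[of v] vW obtain u where uW: "u \<in> W"
    and conv: "(\<lambda>n. a (\<lambda>x. u x - v n x) (\<lambda>x. u x - v n x)) \<longlonglongrightarrow> 0"
    by blast
  have "J u \<le> I + ((1/4) ^ n / 2 + 2 * a (\<lambda>x. u x - v n x) (\<lambda>x. u x - v n x))" for n
  proof -
    let ?d = "\<lambda>x. u x - v n x"
    have d: "?d \<in> W" using diffW uW vW by blast
    have "J (\<lambda>x. v n x + 1 * ?d x) = J (v n) + 2 * 1 * (a (v n) ?d - F ?d) + 1\<^sup>2 * a ?d ?d"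
      by (rule expand[OF vW d])
    then have e1: "J u = J (v n) + 2 * (a (v n) ?d - F ?d) + a ?d ?d" by simp
    \<comment> \<open>The reflected point \<open>v n - d\<close> also lies above the infimum, which bounds the linear term.\<close>
    have "I \<le> J (\<lambda>x. v n x + (-1) * ?d x)"
      by (intro I_le comb vW d)
    also have "\<dots> = J (v n) + 2 * (-1) * (a (v n) ?d - F ?d) + (-1)\<^sup>2 * a ?d ?d"
      by (rule expand[OF vW d])
    finally show ?thesis
      using e1 vJ[of n] by simp
  qed
  moreover have "(\<lambda>n. I + ((1/4) ^ n / 2 + 2 * a (\<lambda>x. u x - v n x) (\<lambda>x. u x - v n x)))
      \<longlonglongrightarrow> I + (0 / 2 + 2 * 0)"
    by (intro tendsto_intros conv LIMSEQ_power_zero) auto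
  ultimately have "J u \<le> I"
    by (intro LIMSEQ_le_const[where a = "J u"]) auto
  have "a u w = F w" if w: "w \<in> W" for w
  proof (rule ccontr)
    define b where "b = a u w - F w"
    define c where "c = \<bar>a w w\<bar> + 1"
    \<comment> \<open>Along the line through \<open>u\<close> in direction \<open>w\<close>, a nonzero slope would allow a decrease.\<close>
    assume "a u w \<noteq> F w"
    then have "b \<noteq> 0" by (simp add: b_def)
    have "c > 0" "a w w < c" by (auto simp: c_def)
    have "J u \<le> J (\<lambda>x. u x + (- b / c) * w x)"
      using \<open>J u \<le> I\<close> I_le[OF comb[OF uW w]] order_trans by blast
    then have "0 \<le> 2 * (- b / c) * b + (- b / c)\<^sup>2 * a w w"
      using expand[OF uW w, of "- b / c"] by (simp add: b_def)
    also have "\<dots> \<le> 2 * (- b / c) * b + (- b / c)\<^sup>2 * c"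
      using \<open>a w w < c\<close> by (intro add_left_mono mult_left_mono) auto
    also have "\<dots> = - b\<^sup>2 / c"
      using \<open>c > 0\<close> by (simp add: field_simps power2_eq_square)
    also have "\<dots> < 0"
      using \<open>c > 0\<close> \<open>b \<noteq> 0\<close> by (simp add: divide_neg_pos)
    finally show False by simp
  qed
  with uW show ?thesis by blast
qed

section \<open>Auxiliary facts on integrals and square-integrable functions\<close>

lemma young_2: "0 < \<delta> \<Longrightarrow> 2 * (a * b) \<le> a\<^sup>2 / \<delta> + \<delta> * b\<^sup>2" for a b \<delta> :: real
proof -
  assume "0 < \<delta>"
  then have "a\<^sup>2 / \<delta> + \<delta> * b\<^sup>2 - 2 * (a * b) = (a - \<delta> * b)\<^sup>2 / \<delta>"
    by (simp add: field_simps power2_eq_square)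
  also have "\<dots> \<ge> 0" using \<open>0 < \<delta>\<close> by simp
  finally show ?thesis by simp
qed

lemma ennreal_divide_left:
  assumes "0 < a" "ennreal a * X \<le> Y"
  shows "X \<le> ennreal (1 / a) * Y"
proof -
  have "X = ennreal (1 / a) * (ennreal a * X)"
    using \<open>0 < a\<close> by (simp add: mult.assoc[symmetric] ennreal_mult[symmetric])
  also have "\<dots> \<le> ennreal (1 / a) * Y"
    by (intro mult_left_mono assms) simp
  finally show ?thesis .
qed

text \<open>Some point does at least as well as the average. With it, a constant \<open>c = u y\<close> can be picked
  for which \<open>\<integral>\<^sub>\<Omega> (u - c)\<^sup>2\<close> is small without knowing that \<open>u\<close> is integrable.\<close>

lemma exists_le_mean:
  fixes g :: "'b \<Rightarrow> ennreal"
  assumes [measurable]: "g \<in> borel_measurable M"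
    and a: "0 < a" "emeasure M (space M) = ennreal a"
    and le: "(\<integral>\<^sup>+ y. g y \<partial>M) \<le> L"
  shows "\<exists>y\<in>space M. g y \<le> ennreal (1 / a) * L"
proof (rule ccontr)
  let ?m = "ennreal (1 / a) * L"
  assume "\<not> ?thesis"
  then have gt: "?m < g y" if "y \<in> space M" for y using that by (auto simp: not_le)
  obtain y where "y \<in> space M" using a by (cases "space M = {}") auto
  with gt have "?m < \<infinity>" using less_le_trans[OF gt top_greatest] by auto
  have "L = ennreal a * ?m"
    using a by (simp add: mult.assoc[symmetric] ennreal_mult[symmetric])
  then have fin: "(\<integral>\<^sup>+ y. ?m \<partial>M) = L" by (simp add: a mult.commute)
  have "L < \<infinity>"
    using \<open>?m < \<infinity>\<close> \<open>L = ennreal a * ?m\<close> by (auto simp: ennreal_mult_less_top)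
  have "\<not> (AE y in M. g y \<le> ?m)"
  proof
    assume "AE y in M. g y \<le> ?m"
    then have "AE y in M. False" by (rule AE_mp) (use gt in \<open>auto intro!: AE_I2 simp: not_le\<close>)
    then show False using a by (simp add: eventually_False ae_filter_eq_bot_iff)
  qed
  then have "(\<integral>\<^sup>+ y. ?m \<partial>M) < (\<integral>\<^sup>+ y. g y \<partial>M)"
    using gt fin \<open>L < \<infinity>\<close> by (intro nn_integral_less) (auto intro: less_imp_le)
  then show False using fin le by simp
qed

lemma sq_diff_le: "(a - b)\<^sup>2 \<le> 2 * a\<^sup>2 + 2 * b\<^sup>2" for a b :: real
  using zero_le_power2[of "a + b"] by (simp add: power2_eq_square algebra_simps)

lemma L2_mult_integrable:
  assumes "in_L2 M g" "in_L2 M h"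
  shows "integrable M (\<lambda>x. g x * h x)"
proof -
  have [measurable]: "g \<in> borel_measurable M" "h \<in> borel_measurable M"
    using assms by (auto simp: in_L2_def)
  have "integrable M (\<lambda>x. (g x)\<^sup>2)" "integrable M (\<lambda>x. (h x)\<^sup>2)"
    using assms by (auto simp: in_L2_def intro!: integrableI_nonneg)
  then have "integrable M (\<lambda>x. (g x)\<^sup>2 + (h x)\<^sup>2)" by simp
  then show ?thesis
  proof (rule Bochner_Integration.integrable_bound)
    show "AE x in M. norm (g x * h x) \<le> norm ((g x)\<^sup>2 + (h x)\<^sup>2)"
    proof (rule AE_I2)
      fix x
      have "\<bar>g x\<bar> * \<bar>h x\<bar> \<le> (g x)\<^sup>2 + (h x)\<^sup>2"
        using zero_le_power2[of "\<bar>g x\<bar> - \<bar>h x\<bar>"] zero_le_power2[of "g x"] zero_le_power2[of "h x"]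
        unfolding power2_diff power2_abs by linarith
      then show "norm (g x * h x) \<le> norm ((g x)\<^sup>2 + (h x)\<^sup>2)" by (simp add: abs_mult)
    qed
  qed simp
qed

lemma L2_comb:
  assumes "in_L2 M g" "in_L2 M h"
  shows "in_L2 M (\<lambda>x. g x + t * h x)"
proof -
  have [measurable]: "g \<in> borel_measurable M" "h \<in> borel_measurable M"
    using assms by (auto simp: in_L2_def)
  have "integrable M (\<lambda>x. g x * g x + 2 * t * (g x * h x) + t\<^sup>2 * (h x * h x))"
    by (intro Bochner_Integration.integrable_add integrable_mult_right L2_mult_integrable assms)
  also have "(\<lambda>x. g x * g x + 2 * t * (g x * h x) + t\<^sup>2 * (h x * h x)) = (\<lambda>x. (g x + t * h x)\<^sup>2)"
    by (auto simp: power2_eq_square algebra_simps)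
  finally show ?thesis
    using integrableD(2) by (auto simp: in_L2_def integrable_iff_bounded)
qed

text \<open>Geometric decay of the squared \<open>L\<^sup>2\<close> norms with ratio \<open>1/4\<close> leaves room for the weight \<open>2\<^sup>n\<close>:
  the sum of \<open>2\<^sup>n (d n x)\<^sup>2\<close> has finite integral, so it is finite almost everywhere.\<close>

lemma L2_fast_AE_summable:
  fixes d :: "nat \<Rightarrow> 'b \<Rightarrow> real"
  assumes [measurable]: "\<And>n. d n \<in> borel_measurable M"
    and le: "\<And>n. (\<integral>\<^sup>+x. ennreal ((d n x)\<^sup>2) \<partial>M) \<le> ennreal (K * (1/4) ^ n)" and "0 \<le> K"
  shows "AE x in M. summable (\<lambda>n. d n x)"
proof -
  have "(\<integral>\<^sup>+x. (\<Sum>n. ennreal (2 ^ n * (d n x)\<^sup>2)) \<partial>M)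
      = (\<Sum>n. \<integral>\<^sup>+x. ennreal (2 ^ n * (d n x)\<^sup>2) \<partial>M)"
    by (intro nn_integral_suminf) measurable
  also have "\<dots> \<le> (\<Sum>n. ennreal (K * (1/2) ^ n))"
  proof (rule suminf_le)
    fix n
    have "(\<integral>\<^sup>+x. ennreal (2 ^ n * (d n x)\<^sup>2) \<partial>M) = ennreal (2 ^ n) * (\<integral>\<^sup>+x. ennreal ((d n x)\<^sup>2) \<partial>M)"
      by (simp add: ennreal_mult' nn_integral_cmult)
    also have "\<dots> \<le> ennreal (2 ^ n) * ennreal (K * (1/4) ^ n)"
      by (intro mult_left_mono le) simp
    also have "\<dots> = ennreal (K * (2 ^ n * (1/4) ^ n))"
      using \<open>0 \<le> K\<close> by (subst ennreal_mult[symmetric]) (auto simp: mult_ac)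
    also have "2 ^ n * (1/4) ^ n = (1/2::real) ^ n"
      by (simp add: power_mult_distrib[symmetric])
    finally show "(\<integral>\<^sup>+x. ennreal (2 ^ n * (d n x)\<^sup>2) \<partial>M) \<le> ennreal (K * (1/2) ^ n)" .
  qed auto
  also have "\<dots> = ennreal (\<Sum>n. K * (1/2) ^ n)"
    using \<open>0 \<le> K\<close> by (intro suminf_ennreal2 summable_mult summable_geometric) auto
  also have "\<dots> < \<infinity>" by simp
  finally have "AE x in M. (\<Sum>n. ennreal (2 ^ n * (d n x)\<^sup>2)) \<noteq> \<infinity>"
    by (intro nn_integral_PInf_AE) auto
  then show ?thesis
  proof (rule AE_mp, intro AE_I2 impI)
    fix x
    assume fin: "(\<Sum>n. ennreal (2 ^ n * (d n x)\<^sup>2)) \<noteq> \<infinity>"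
    have "summable (\<lambda>n. 2 ^ n * (d n x)\<^sup>2)"
      by (rule summable_suminf_not_top) (use fin in auto)
    then have "Bseq (\<lambda>n. 2 ^ n * (d n x)\<^sup>2)"
      by (intro convergent_imp_Bseq convergentI[OF summable_LIMSEQ_zero])
    then obtain B where B: "B > 0" "\<And>n. \<bar>2 ^ n * (d n x)\<^sup>2\<bar> \<le> B"
      by (auto simp: Bseq_def)
    \<comment> \<open>So \<open>\<bar>d n x\<bar>\<close> is dominated by a geometric sequence of ratio \<open>sqrt (1/2)\<close>.\<close>
    have "norm (d n x) \<le> sqrt B * sqrt (1/2) ^ n" for n
    proof (rule power2_le_imp_le)
      have "(d n x)\<^sup>2 \<le> B * (1/2) ^ n"
        using B(2)[of n] by (simp add: field_simps)
      also have "\<dots> = (sqrt B * sqrt (1/2) ^ n)\<^sup>2"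
        using \<open>B > 0\<close> by (simp add: power_mult_distrib real_sqrt_power[symmetric])
      finally show "(norm (d n x))\<^sup>2 \<le> (sqrt B * sqrt (1/2) ^ n)\<^sup>2" by simp
    qed (use \<open>B > 0\<close> in auto)
    then have geo: "\<And>n. 0 \<le> n \<Longrightarrow> norm (d n x) \<le> sqrt B * sqrt (1/2) ^ n" by blast
    have "summable (\<lambda>n. sqrt B * sqrt (1/2) ^ n)"
      by (intro summable_mult summable_geometric) (simp add: real_sqrt_divide)
    from this geo show "summable (\<lambda>n. d n x)"
      by (rule summable_comparison_test')
  qed
qed

text \<open>Fatou's lemma, in the form of lower semicontinuity of the squared \<open>L\<^sup>2\<close> norm under almost
  everywhere convergence.\<close>

lemma nn_integral_sq_limit_le:
  fixes g :: "nat \<Rightarrow> 'b \<Rightarrow> real"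
  assumes [measurable]: "\<And>m. g m \<in> borel_measurable M"
    and lim: "AE x in M. (\<lambda>m. g m x) \<longlonglongrightarrow> h x"
    and le: "\<And>m. n \<le> m \<Longrightarrow> (\<integral>\<^sup>+x. ennreal ((g m x)\<^sup>2) \<partial>M) \<le> L"
  shows "(\<integral>\<^sup>+x. ennreal ((h x)\<^sup>2) \<partial>M) \<le> L"
proof -
  have "(\<integral>\<^sup>+x. ennreal ((h x)\<^sup>2) \<partial>M) = (\<integral>\<^sup>+x. liminf (\<lambda>m. ennreal ((g m x)\<^sup>2)) \<partial>M)"
  proof (rule nn_integral_cong_AE, rule AE_mp[OF lim], intro AE_I2 impI)
    fix x assume "(\<lambda>m. g m x) \<longlonglongrightarrow> h x"
    then have "(\<lambda>m. ennreal ((g m x)\<^sup>2)) \<longlonglongrightarrow> ennreal ((h x)\<^sup>2)"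
      by (intro tendsto_ennrealI tendsto_power)
    then show "ennreal ((h x)\<^sup>2) = liminf (\<lambda>m. ennreal ((g m x)\<^sup>2))"
      by (intro lim_imp_Liminf[symmetric]) auto
  qed
  also have "\<dots> \<le> liminf (\<lambda>m. \<integral>\<^sup>+x. ennreal ((g m x)\<^sup>2) \<partial>M)"
    by (rule nn_integral_liminf) measurable
  also have "\<dots> \<le> L"
    by (rule Liminf_le) (use le in \<open>auto simp: eventually_sequentially\<close>)
  finally show ?thesis .
qed

lemma sigma_finite_lebesgue: "sigma_finite_measure (lebesgue :: 'a::euclidean_space measure)"
proof
  obtain A :: "nat \<Rightarrow> 'a set" where "range A \<subseteq> sets lborel" "(\<Union>i. A i) = space lborel"
    "\<And>i. emeasure lborel (A i) \<noteq> \<infinity>"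
    using lborel.sigma_finite by blast
  then show "\<exists>A. countable A \<and> A \<subseteq> sets (lebesgue :: 'a measure) \<and> \<Union> A = space lebesgue
      \<and> (\<forall>a\<in>A. emeasure lebesgue a \<noteq> \<infinity>)"
    by (intro exI[of _ "range A"]) (auto simp: image_subset_iff)
qed

interpretation lebesgue: sigma_finite_measure lebesgue
  by (rule sigma_finite_lebesgue)

interpretation lebesgue_pair: pair_sigma_finite lebesgue lebesgue ..

lemma AE_lebesgue_pairI:
  assumes "AE x in lebesgue. P x"
  shows "AE p in lebesgue \<Otimes>\<^sub>M (lebesgue :: 'a::euclidean_space measure). P (fst p) \<and> P (snd p)"
proof -
  obtain N where N: "N \<in> null_sets lebesgue" "\<And>x. x \<notin> N \<Longrightarrow> P x"
    using assms by (auto simp: eventually_ae_filter)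
  have "N \<times> UNIV \<in> null_sets (lebesgue \<Otimes>\<^sub>M (lebesgue :: 'a measure))"
    using N(1) by (intro lebesgue.times_in_null_sets1) auto
  moreover have "UNIV \<times> N \<in> null_sets (lebesgue \<Otimes>\<^sub>M (lebesgue :: 'a measure))"
    using N(1) by (intro lebesgue.times_in_null_sets2) auto
  ultimately have "AE p in lebesgue \<Otimes>\<^sub>M (lebesgue :: 'a measure). p \<notin> N \<times> UNIV \<and> p \<notin> UNIV \<times> N"
    by (intro AE_conjI AE_not_in)
  then show ?thesis
    by (rule AE_mp) (use N(2) in \<open>auto simp: mem_Times_iff\<close>)
qed

section \<open>The energy of the Robin problem\<close>

lemma C_const_pos:
  assumes "0 < s" "s < 1"
  shows "0 < C_const N s"
proof -
  have "0 < Gamma ((2 * s + real N) / 2)" "0 < Gamma (1 - s)"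
    using assms by (auto intro!: Gamma_real_pos add_pos_nonneg)
  then show ?thesis
    unfolding C_const_def using assms by (intro divide_pos_pos mult_pos_pos) auto
qed

text \<open>The weight \<open>\<bar>x - y\<bar>\<^sup>-\<^sup>N\<^sup>-\<^sup>2\<^sup>s\<close> is absorbed into a measure so that the Gagliardo seminorm becomes
  the \<open>L\<^sup>2\<close> norm of \<open>increment u\<close>, and the whole bilinear form a sum of two \<open>L\<^sup>2\<close> inner products.
  On the diagonal the weight is \<open>1 / 0 = 0\<close>, in agreement with the zero integrand.\<close>

definition interaction_measure :: "real \<Rightarrow> 'a::euclidean_space set \<Rightarrow> ('a \<times> 'a) measure" where
  "interaction_measure s \<Omega> = density (lebesgue \<Otimes>\<^sub>M lebesgue)
     (\<lambda>p. ennreal (indicator (interaction_region \<Omega>) p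
        * (1 / norm (fst p - snd p) powr (real DIM('a) + 2 * s))))"

definition increment :: "('a \<Rightarrow> real) \<Rightarrow> 'a \<times> 'a \<Rightarrow> real" where
  "increment u p = u (fst p) - u (snd p)"

definition robin_energy ::
  "real \<Rightarrow> 'a::euclidean_space set \<Rightarrow> ('a \<Rightarrow> real) \<Rightarrow> ('a \<Rightarrow> real) \<Rightarrow> ennreal" where
  "robin_energy s \<Omega> \<kappa> u =
     (\<integral>\<^sup>+ p. ennreal ((increment u p)\<^sup>2) \<partial>interaction_measure s \<Omega>)
   + (\<integral>\<^sup>+ x. ennreal ((u x)\<^sup>2) \<partial>exterior_measure \<Omega> \<kappa>)"

locale robin_data =
  fixes s :: real and \<Omega> :: "'a::euclidean_space set" and \<kappa> :: "'a \<Rightarrow> real"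
  assumes s_pos: "0 < s" and open_dom: "open \<Omega>" and bounded_dom: "bounded \<Omega>"
    and dom_ne: "\<Omega> \<noteq> {}"
    and \<kappa>_int: "integrable (lebesgue_on (- \<Omega>)) \<kappa>"
    and \<kappa>_nonneg: "AE x in lebesgue_on (- \<Omega>). 0 \<le> \<kappa> x"
begin

lemma dom_sets [measurable, simp]: "\<Omega> \<in> sets lebesgue" "- \<Omega> \<in> sets lebesgue"
  using open_dom by (auto simp: Compl_in_sets_lebesgue borel_open)

lemma \<kappa>_measurable [measurable]: "\<kappa> \<in> borel_measurable (lebesgue_on (- \<Omega>))"
  using \<kappa>_int by blast

lemma region_sets [measurable]: "interaction_region \<Omega> \<in> sets (lebesgue \<Otimes>\<^sub>M lebesgue)"
  unfolding interaction_region_def by (intro sets.Un pair_measureI dom_sets)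

lemma id_borel_measurable [measurable]: "(\<lambda>x. x) \<in> lebesgue \<rightarrow>\<^sub>M borel"
  using measurable_completion[of "\<lambda>x. x" lborel borel] by simp

lemma norm_diff_measurable [measurable]:
  "(\<lambda>p. norm (fst p - snd p)) \<in> borel_measurable (lebesgue \<Otimes>\<^sub>M (lebesgue :: 'a measure))"
proof -
  have [measurable]: "fst \<in> borel_measurable (lebesgue \<Otimes>\<^sub>M (lebesgue :: 'a measure))"
    "snd \<in> borel_measurable (lebesgue \<Otimes>\<^sub>M (lebesgue :: 'a measure))"
    using measurable_compose[OF measurable_fst id_borel_measurable]
      measurable_compose[OF measurable_snd id_borel_measurable] by auto
  show ?thesis by measurable
qed

lemma measurable_exteriorI:
  assumes "u \<in> borel_measurable (lebesgue_on (- \<Omega>))"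
  shows "u \<in> borel_measurable (exterior_measure \<Omega> \<kappa>)"
  using assms by (simp add: exterior_measure_def)

lemma measurable_exterior:
  assumes "u \<in> borel_measurable lebesgue"
  shows "u \<in> borel_measurable (exterior_measure \<Omega> \<kappa>)"
  using assms by (intro measurable_exteriorI measurable_restrict_space1)

lemma increment_measurable [measurable]:
  fixes u :: "'a \<Rightarrow> real"
  assumes [measurable]: "u \<in> borel_measurable lebesgue"
  shows "increment u \<in> borel_measurable (lebesgue \<Otimes>\<^sub>M lebesgue)"
  unfolding increment_def by measurable

lemma increment_measurable_interaction [measurable]:
  assumes "u \<in> borel_measurable lebesgue"
  shows "increment u \<in> borel_measurable (interaction_measure s \<Omega>)"
  using assms by (simp add: interaction_measure_def increment_measurable)

lemma W_sqnorm_eq: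
  assumes [measurable]: "u \<in> borel_measurable lebesgue"
  shows "W_sqnorm s \<Omega> \<kappa> u
    = (\<integral>\<^sup>+ x. ennreal ((u x)\<^sup>2) \<partial>lebesgue_on \<Omega>) + robin_energy s \<Omega> \<kappa> u"
proof -
  have "(\<integral>\<^sup>+ p. ennreal ((increment u p)\<^sup>2) \<partial>interaction_measure s \<Omega>)
      = (\<integral>\<^sup>+ (x, y)\<in>interaction_region \<Omega>.
        ennreal ((u x - u y)\<^sup>2 / norm (x - y) powr (real DIM('a) + 2 * s))
        \<partial>(lebesgue \<Otimes>\<^sub>M lebesgue))"
    unfolding interaction_measure_def
    by (subst nn_integral_density)
       (auto intro!: nn_integral_cong split: split_indicator
          simp: ennreal_mult[symmetric] increment_def)
  then show ?thesis
    by (simp add: W_sqnorm_def robin_energy_def add.assoc)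
qed

lemma emeasure_finite_if_bounded:
  fixes B :: "'a set"
  assumes "B \<in> sets lebesgue" "bounded B"
  shows "emeasure lebesgue B < \<infinity>"
  using bounded_set_imp_lmeasurable[of B] assms by (auto simp: fmeasurable_def)

lemma dom_emeasure: "emeasure lebesgue \<Omega> < \<infinity>" "emeasure lebesgue \<Omega> \<noteq> 0"
  using emeasure_finite_if_bounded[of \<Omega>] bounded_dom open_not_negligible[OF open_dom dom_ne]
  by (auto simp: negligible_iff_emeasure0)

section \<open>Poincare inequalities\<close>

text \<open>For \<open>x\<close> and \<open>y\<close> in bounded sets, \<open>\<bar>x - y\<bar>\<close> is bounded, so the kernel \<open>\<bar>x - y\<bar>\<^sup>-\<^sup>N\<^sup>-\<^sup>2\<^sup>s\<close> is bounded
  away from zero.\<close>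

lemma increments_le_energy:
  assumes [measurable]: "A \<in> sets lebesgue" "B \<in> sets lebesgue"
    and AB: "A \<times> B \<subseteq> interaction_region \<Omega>" and bdd: "bounded A" "bounded B"
  obtains R :: real where "0 \<le> R" "\<And>u. u \<in> borel_measurable lebesgue \<Longrightarrow>
    (\<integral>\<^sup>+ y. \<integral>\<^sup>+ x. ennreal ((u x - u y)\<^sup>2) \<partial>lebesgue_on A \<partial>lebesgue_on B)
      \<le> ennreal R * (\<integral>\<^sup>+ p. ennreal ((increment u p)\<^sup>2) \<partial>interaction_measure s \<Omega>)"
proof -
  define e where "e = real DIM('a) + 2 * s"
  have "bounded (A \<union> B)" using bdd by simp
  then obtain r where r: "\<And>x. x \<in> A \<union> B \<Longrightarrow> norm x \<le> r"
    unfolding bounded_iff by blast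
  define R where "R = (2 * \<bar>r\<bar>) powr e"
  have "e \<ge> 0" using s_pos by (simp add: e_def)
  have weight: "d \<le> R * (d / norm (x - y) powr e)"
    if "x \<in> A" "y \<in> B" "0 \<le> d" "x = y \<Longrightarrow> d = 0" for x y d
  proof (cases "x = y")
    case False
    have "norm (x - y) \<le> 2 * \<bar>r\<bar>"
      using norm_triangle_ineq4[of x y] r[of x] r[of y] that(1,2) by simp
    then have "norm (x - y) powr e \<le> R"
      unfolding R_def using \<open>e \<ge> 0\<close> by (intro powr_mono2) auto
    moreover have "0 < norm (x - y) powr e" using False by simp
    ultimately have "1 \<le> R / norm (x - y) powr e" by simp
    then have "1 * d \<le> R / norm (x - y) powr e * d"
      using \<open>0 \<le> d\<close> by (rule mult_right_mono)
    then show ?thesis by simp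
  qed (use that in simp)
  have "(\<integral>\<^sup>+ y. \<integral>\<^sup>+ x. ennreal ((u x - u y)\<^sup>2) \<partial>lebesgue_on A \<partial>lebesgue_on B)
      \<le> ennreal R * (\<integral>\<^sup>+ p. ennreal ((increment u p)\<^sup>2) \<partial>interaction_measure s \<Omega>)"
    if [measurable]: "u \<in> borel_measurable lebesgue" for u
  proof -
    let ?f = "\<lambda>p. ennreal ((increment u p)\<^sup>2) * indicator (A \<times> B) p"
    have "(\<integral>\<^sup>+ y. \<integral>\<^sup>+ x. ennreal ((u x - u y)\<^sup>2) \<partial>lebesgue_on A \<partial>lebesgue_on B)
        = (\<integral>\<^sup>+ y. \<integral>\<^sup>+ x. ?f (x, y) \<partial>lebesgue \<partial>lebesgue)"
      by (auto simp: nn_integral_restrict_space nn_integral_multc[symmetric] increment_def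
          intro!: nn_integral_cong split: split_indicator)
    also have "\<dots> = (\<integral>\<^sup>+ p. ?f p \<partial>(lebesgue \<Otimes>\<^sub>M lebesgue))"
      by (rule lebesgue_pair.nn_integral_snd) measurable
    also have "\<dots> \<le> (\<integral>\<^sup>+ p. ennreal R * (ennreal (indicator (interaction_region \<Omega>) p
        * (1 / norm (fst p - snd p) powr e)) * ennreal ((increment u p)\<^sup>2))
        \<partial>(lebesgue \<Otimes>\<^sub>M lebesgue))"
    proof (rule nn_integral_mono)
      fix p :: "'a \<times> 'a"
      show "?f p \<le> ennreal R * (ennreal (indicator (interaction_region \<Omega>) p
          * (1 / norm (fst p - snd p) powr e)) * ennreal ((increment u p)\<^sup>2))"
      proof (cases "p \<in> A \<times> B")
        case True
        then have "(increment u p)\<^sup>2 \<le> R * ((increment u p)\<^sup>2 / norm (fst p - snd p) powr e)"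
          by (intro weight) (auto simp: increment_def)
        moreover have "p \<in> interaction_region \<Omega>" using True AB by blast
        ultimately show ?thesis
          using True by (simp add: ennreal_mult[symmetric] R_def)
      qed simp
    qed
    also have "\<dots> = ennreal R * (\<integral>\<^sup>+ p. ennreal ((increment u p)\<^sup>2) \<partial>interaction_measure s \<Omega>)"
      unfolding interaction_measure_def e_def
      by (subst nn_integral_density) (auto simp: nn_integral_cmult)
    finally show ?thesis .
  qed
  moreover have "0 \<le> R" by (simp add: R_def)
  ultimately show ?thesis using that by blast
qed

text \<open>Integrate \<open>(u y)\<^sup>2 \<le> 2 (u x - u y)\<^sup>2 + 2 (u x)\<^sup>2\<close> over \<open>x\<close> in \<open>A\<close> and \<open>y\<close> in \<open>B\<close>: the left side does
  not depend on \<open>x\<close>, which produces the factor \<open>emeasure lebesgue A\<close>.\<close>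

lemma L2_transfer:
  assumes [measurable]: "A \<in> sets lebesgue" "B \<in> sets lebesgue"
    and AB: "A \<times> B \<subseteq> interaction_region \<Omega>" and bdd: "bounded A" "bounded B"
  obtains R :: real where "0 \<le> R" "\<And>u. u \<in> borel_measurable lebesgue \<Longrightarrow>
    emeasure lebesgue A * (\<integral>\<^sup>+ x. ennreal ((u x)\<^sup>2) \<partial>lebesgue_on B)
      \<le> ennreal R * ((\<integral>\<^sup>+ p. ennreal ((increment u p)\<^sup>2) \<partial>interaction_measure s \<Omega>)
        + (\<integral>\<^sup>+ x. ennreal ((u x)\<^sup>2) \<partial>lebesgue_on A))"
proof -
  obtain R where R: "0 \<le> R" and incr: "\<And>u. u \<in> borel_measurable lebesgue \<Longrightarrow>
    (\<integral>\<^sup>+ y. \<integral>\<^sup>+ x. ennreal ((u x - u y)\<^sup>2) \<partial>lebesgue_on A \<partial>lebesgue_on B)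
      \<le> ennreal R * (\<integral>\<^sup>+ p. ennreal ((increment u p)\<^sup>2) \<partial>interaction_measure s \<Omega>)"
    using increments_le_energy[OF assms] by blast
  obtain b where b: "0 \<le> b" "emeasure lebesgue B = ennreal b"
    using emeasure_finite_if_bounded[OF assms(2) bdd(2)]
    by (cases "emeasure lebesgue B") auto
  have "emeasure lebesgue A * (\<integral>\<^sup>+ x. ennreal ((u x)\<^sup>2) \<partial>lebesgue_on B)
      \<le> ennreal (2 * R + 2 * b)
        * ((\<integral>\<^sup>+ p. ennreal ((increment u p)\<^sup>2) \<partial>interaction_measure s \<Omega>)
        + (\<integral>\<^sup>+ x. ennreal ((u x)\<^sup>2) \<partial>lebesgue_on A))" (is "_ \<le> _ * (?E + ?A)")
    if u [measurable]: "u \<in> borel_measurable lebesgue" for u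
  proof -
    have [measurable]: "u \<in> borel_measurable (lebesgue_on A)" "u \<in> borel_measurable (lebesgue_on B)"
      using u by (auto intro: measurable_restrict_space1)
    have sq: "ennreal ((u y)\<^sup>2) \<le> 2 * ennreal ((u x - u y)\<^sup>2) + 2 * ennreal ((u x)\<^sup>2)" for x y
    proof -
      have "(u y)\<^sup>2 \<le> 2 * (u x)\<^sup>2 + 2 * (u x - u y)\<^sup>2"
        using sq_diff_le[of "u x" "u x - u y"] by simp
      then have "ennreal ((u y)\<^sup>2) \<le> ennreal (2 * (u x - u y)\<^sup>2 + 2 * (u x)\<^sup>2)"
        by (intro ennreal_leI) simp
      then show ?thesis by (simp add: ennreal_mult)
    qed
    have "emeasure lebesgue A * (\<integral>\<^sup>+ y. ennreal ((u y)\<^sup>2) \<partial>lebesgue_on B)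
        = (\<integral>\<^sup>+ y. \<integral>\<^sup>+ x. ennreal ((u y)\<^sup>2) \<partial>lebesgue_on A \<partial>lebesgue_on B)"
      by (simp add: nn_integral_cmult[symmetric] emeasure_restrict_space mult.commute)
    also have "\<dots> \<le> (\<integral>\<^sup>+ y. \<integral>\<^sup>+ x. 2 * ennreal ((u x - u y)\<^sup>2) + 2 * ennreal ((u x)\<^sup>2)
        \<partial>lebesgue_on A \<partial>lebesgue_on B)"
      by (intro nn_integral_mono sq)
    also have "\<dots> = (\<integral>\<^sup>+ y. (2 * (\<integral>\<^sup>+ x. ennreal ((u x - u y)\<^sup>2) \<partial>lebesgue_on A) + 2 * ?A)
        \<partial>lebesgue_on B)"
      by (intro nn_integral_cong) (simp add: nn_integral_add nn_integral_cmult)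
    also have "\<dots> = 2 * (\<integral>\<^sup>+ y. \<integral>\<^sup>+ x. ennreal ((u x - u y)\<^sup>2) \<partial>lebesgue_on A \<partial>lebesgue_on B)
        + 2 * ?A * ennreal b"
    proof -
      have [measurable]: "(\<lambda>y. \<integral>\<^sup>+ x. ennreal ((u x - u y)\<^sup>2) \<partial>lebesgue_on A)
          \<in> borel_measurable (lebesgue_on B)"
      proof -
        have "(\<lambda>y. \<integral>\<^sup>+ x. ennreal ((u x - u y)\<^sup>2) * indicator A x \<partial>lebesgue)
            \<in> borel_measurable lebesgue"
          by measurable
        then show ?thesis
          by (intro measurable_restrict_space1) (simp add: nn_integral_restrict_space)
      qed
      show ?thesis
        by (simp add: nn_integral_add nn_integral_cmult emeasure_restrict_space b)
    qed
    also have "\<dots> \<le> 2 * (ennreal R * ?E) + 2 * ?A * ennreal b"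
      by (intro add_right_mono mult_left_mono incr u) simp
    also have "\<dots> \<le> ennreal (2 * R + 2 * b) * ?E + ennreal (2 * R + 2 * b) * ?A"
    proof (intro add_mono)
      have "2 * (ennreal R * ?E) = ennreal (2 * R) * ?E"
        using R by (simp add: ennreal_mult mult_ac)
      also have "\<dots> \<le> ennreal (2 * R + 2 * b) * ?E"
        using b by (intro mult_right_mono ennreal_leI) auto
      finally show "2 * (ennreal R * ?E) \<le> ennreal (2 * R + 2 * b) * ?E" .
      have "2 * ?A * ennreal b = ennreal (2 * b) * ?A"
        using b by (simp add: ennreal_mult mult_ac)
      also have "\<dots> \<le> ennreal (2 * R + 2 * b) * ?A"
        using R by (intro mult_right_mono ennreal_leI) auto
      finally show "2 * ?A * ennreal b \<le> ennreal (2 * R + 2 * b) * ?A" .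
    qed
    finally show ?thesis by (simp add: distrib_left)
  qed
  moreover have "0 \<le> 2 * R + 2 * b" using R b by simp
  ultimately show ?thesis using that by blast
qed

text \<open>Since \<open>\<Omega> \<times> B\<close> lies in the interaction region for every \<open>B\<close>, the values of \<open>u\<close> far outside
  \<open>\<Omega>\<close> are controlled even where \<open>\<kappa>\<close> vanishes. This is what makes limits exist on the whole space.\<close>

lemma L2_local_control:
  assumes [measurable]: "B \<in> sets lebesgue" and "bounded B"
  obtains K :: real where "0 \<le> K" "\<And>u. u \<in> borel_measurable lebesgue \<Longrightarrow>
    (\<integral>\<^sup>+ x. ennreal ((u x)\<^sup>2) \<partial>lebesgue_on B)
      \<le> ennreal K * ((\<integral>\<^sup>+ x. ennreal ((u x)\<^sup>2) \<partial>lebesgue_on \<Omega>) + robin_energy s \<Omega> \<kappa> u)"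
proof -
  have "\<Omega> \<times> B \<subseteq> interaction_region \<Omega>" by (auto simp: interaction_region_def)
  then obtain R where R: "0 \<le> R" and le: "\<And>u. u \<in> borel_measurable lebesgue \<Longrightarrow>
    emeasure lebesgue \<Omega> * (\<integral>\<^sup>+ x. ennreal ((u x)\<^sup>2) \<partial>lebesgue_on B)
      \<le> ennreal R * ((\<integral>\<^sup>+ p. ennreal ((increment u p)\<^sup>2) \<partial>interaction_measure s \<Omega>)
        + (\<integral>\<^sup>+ x. ennreal ((u x)\<^sup>2) \<partial>lebesgue_on \<Omega>))"
    using L2_transfer[of \<Omega> B] assms bounded_dom by auto
  obtain a where a: "0 < a" "emeasure lebesgue \<Omega> = ennreal a"
    using dom_emeasure by (cases "emeasure lebesgue \<Omega>") (auto simp: less_le)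
  show ?thesis
  proof (rule that[of "1 / a * R"])
    show "0 \<le> 1 / a * R" using a R by simp
    fix u :: "'a \<Rightarrow> real" assume u: "u \<in> borel_measurable lebesgue"
    have "(\<integral>\<^sup>+ x. ennreal ((u x)\<^sup>2) \<partial>lebesgue_on B) \<le> ennreal (1 / a) *
        (ennreal R * ((\<integral>\<^sup>+ p. ennreal ((increment u p)\<^sup>2) \<partial>interaction_measure s \<Omega>)
        + (\<integral>\<^sup>+ x. ennreal ((u x)\<^sup>2) \<partial>lebesgue_on \<Omega>)))"
      using le[OF u] a by (intro ennreal_divide_left) auto
    also have "\<dots> = ennreal (1 / a * R) *
        ((\<integral>\<^sup>+ x. ennreal ((u x)\<^sup>2) \<partial>lebesgue_on \<Omega>)
          + (\<integral>\<^sup>+ p. ennreal ((increment u p)\<^sup>2) \<partial>interaction_measure s \<Omega>))"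
      using a R by (subst ennreal_mult) (auto simp: mult.assoc add.commute)
    also have "\<dots> \<le> ennreal (1 / a * R) * ((\<integral>\<^sup>+ x. ennreal ((u x)\<^sup>2) \<partial>lebesgue_on \<Omega>)
        + robin_energy s \<Omega> \<kappa> u)"
      by (intro mult_left_mono add_left_mono) (auto simp: robin_energy_def)
    finally show "(\<integral>\<^sup>+ x. ennreal ((u x)\<^sup>2) \<partial>lebesgue_on B)
      \<le> ennreal (1 / a * R) * ((\<integral>\<^sup>+ x. ennreal ((u x)\<^sup>2) \<partial>lebesgue_on \<Omega>)
        + robin_energy s \<Omega> \<kappa> u)" .
  qed
qed

lemma poincare_neumann:
  obtains K :: real where "0 \<le> K" "\<And>u. u \<in> borel_measurable lebesgue \<Longrightarrow>
    \<exists>c. (\<integral>\<^sup>+ x. ennreal ((u x - c)\<^sup>2) \<partial>lebesgue_on \<Omega>) \<le> ennreal K * robin_energy s \<Omega> \<kappa> u"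
proof -
  have "\<Omega> \<times> \<Omega> \<subseteq> interaction_region \<Omega>" by (auto simp: interaction_region_def)
  then obtain R where R: "0 \<le> R" and le: "\<And>u. u \<in> borel_measurable lebesgue \<Longrightarrow>
    (\<integral>\<^sup>+ y. \<integral>\<^sup>+ x. ennreal ((u x - u y)\<^sup>2) \<partial>lebesgue_on \<Omega> \<partial>lebesgue_on \<Omega>)
      \<le> ennreal R * (\<integral>\<^sup>+ p. ennreal ((increment u p)\<^sup>2) \<partial>interaction_measure s \<Omega>)"
    using increments_le_energy[of \<Omega> \<Omega>] bounded_dom by auto
  obtain a where a: "0 < a" "emeasure lebesgue \<Omega> = ennreal a"
    using dom_emeasure by (cases "emeasure lebesgue \<Omega>") (auto simp: less_le)
  show ?thesis
  proof (rule that[of "1 / a * R"])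
    show "0 \<le> 1 / a * R" using a R by simp
    fix u :: "'a \<Rightarrow> real" assume u[measurable]: "u \<in> borel_measurable lebesgue"
    have "(\<lambda>y. \<integral>\<^sup>+ x. ennreal ((u x - u y)\<^sup>2) * indicator \<Omega> x \<partial>lebesgue)
        \<in> borel_measurable lebesgue"
      by measurable
    then have "(\<lambda>y. \<integral>\<^sup>+ x. ennreal ((u x - u y)\<^sup>2) \<partial>lebesgue_on \<Omega>)
        \<in> borel_measurable (lebesgue_on \<Omega>)"
      by (intro measurable_restrict_space1) (simp add: nn_integral_restrict_space)
    then obtain y where "(\<integral>\<^sup>+ x. ennreal ((u x - u y)\<^sup>2) \<partial>lebesgue_on \<Omega>) \<le> ennreal (1 / a) *
        (ennreal R * (\<integral>\<^sup>+ p. ennreal ((increment u p)\<^sup>2) \<partial>interaction_measure s \<Omega>))"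
      using exists_le_mean[OF _ a(1) _ le[OF u]] a(2) by (auto simp: emeasure_restrict_space)
    also have "\<dots> \<le> ennreal (1 / a) * (ennreal R * robin_energy s \<Omega> \<kappa> u)"
      by (intro mult_left_mono) (auto simp: robin_energy_def)
    also have "\<dots> = ennreal (1 / a * R) * robin_energy s \<Omega> \<kappa> u"
      using a R by (subst ennreal_mult) (auto simp: mult.assoc)
    finally show "\<exists>c. (\<integral>\<^sup>+ x. ennreal ((u x - c)\<^sup>2) \<partial>lebesgue_on \<Omega>)
        \<le> ennreal (1 / a * R) * robin_energy s \<Omega> \<kappa> u" by blast
  qed
qed

text \<open>The sets \<open>A n\<close> on which \<open>\<kappa> \<ge> 1 / (n + 1)\<close> and \<open>norm x \<le> n\<close> exhaust the set where \<open>\<kappa>\<close> is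
  positive, so one of them has positive measure. On it \<open>u\<^sup>2 \<le> (n + 1) \<kappa> u\<^sup>2\<close>, and the transfer from
  \<open>A n\<close> to \<open>\<Omega>\<close> carries this bound inside.\<close>

lemma poincare_robin:
  assumes nz: "\<not> (AE x in lebesgue_on (- \<Omega>). \<kappa> x = 0)"
  obtains K :: real where "0 \<le> K" "\<And>u. u \<in> borel_measurable lebesgue \<Longrightarrow>
    (\<integral>\<^sup>+ x. ennreal ((u x)\<^sup>2) \<partial>lebesgue_on \<Omega>) \<le> ennreal K * robin_energy s \<Omega> \<kappa> u"
proof -
  define A where "A n = {x \<in> - \<Omega>. norm x \<le> real n \<and> 1 / real (Suc n) \<le> \<kappa> x}" for n
  have A_sets [measurable]: "A n \<in> sets lebesgue" for n
  proof -
    have [measurable]: "(\<lambda>x. x) \<in> borel_measurable (lebesgue_on (- \<Omega>))"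
      by (intro measurable_restrict_space1 id_borel_measurable)
    have "{x \<in> space (lebesgue_on (- \<Omega>)). norm x \<le> real n \<and> 1 / real (Suc n) \<le> \<kappa> x}
        \<in> sets (lebesgue_on (- \<Omega>))"
      by measurable
    then show ?thesis
      by (simp add: A_def sets_restrict_space_iff)
  qed
  have "\<exists>n. emeasure lebesgue (A n) \<noteq> 0"
  proof (rule ccontr)
    assume "\<not> ?thesis"
    then have "AE x in lebesgue. \<forall>n. x \<notin> A n"
      unfolding AE_all_countable by (auto intro!: AE_not_in simp: null_sets_def)
    then have "AE x in lebesgue_on (- \<Omega>). \<forall>n. x \<notin> A n"
      by (simp add: AE_restrict_space_iff)
         (erule AE_mp, simp)
    then have "AE x in lebesgue_on (- \<Omega>). \<kappa> x = 0"
      using \<kappa>_nonneg AE_space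
    proof eventually_elim
      fix x assume *: "\<forall>n. x \<notin> A n" "0 \<le> \<kappa> x" "x \<in> space (lebesgue_on (- \<Omega>))"
      show "\<kappa> x = 0"
      proof (rule ccontr)
        assume "\<kappa> x \<noteq> 0"
        then have "0 < \<kappa> x" using * by simp
        then obtain m where m: "inverse (real (Suc m)) < \<kappa> x" using reals_Archimedean by blast
        obtain k where k: "norm x \<le> real k" using real_arch_simple by blast
        have "1 / real (Suc (max m k)) \<le> inverse (real (Suc m))"
          by (simp add: field_simps)
        then have "1 / real (Suc (max m k)) \<le> \<kappa> x" "norm x \<le> real (max m k)"
          using m k by linarith+
        then have "x \<in> A (max m k)"
          using * unfolding A_def by auto
        then show False using * by blast
      qed
    qed
    then show False using nz by blast
  qed
  then obtain n where n: "emeasure lebesgue (A n) \<noteq> 0" by blast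
  have bdd: "bounded (A n)" unfolding bounded_iff A_def by blast
  obtain a where a: "0 < a" "emeasure lebesgue (A n) = ennreal a"
    using n emeasure_finite_if_bounded[OF A_sets bdd]
    by (cases "emeasure lebesgue (A n)") (auto simp: less_le)
  have "A n \<times> \<Omega> \<subseteq> interaction_region \<Omega>" by (auto simp: interaction_region_def A_def)
  then obtain R where R: "0 \<le> R" and le: "\<And>u. u \<in> borel_measurable lebesgue \<Longrightarrow>
    emeasure lebesgue (A n) * (\<integral>\<^sup>+ x. ennreal ((u x)\<^sup>2) \<partial>lebesgue_on \<Omega>)
      \<le> ennreal R * ((\<integral>\<^sup>+ p. ennreal ((increment u p)\<^sup>2) \<partial>interaction_measure s \<Omega>)
        + (\<integral>\<^sup>+ x. ennreal ((u x)\<^sup>2) \<partial>lebesgue_on (A n)))"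
    using L2_transfer[of "A n" \<Omega>] bdd bounded_dom by auto
  let ?N = "real (Suc n)"
  show ?thesis
  proof (rule that[of "1 / a * (R * ?N)"])
    show "0 \<le> 1 / a * (R * ?N)" using a R by simp
    fix u :: "'a \<Rightarrow> real" assume u[measurable]: "u \<in> borel_measurable lebesgue"
    let ?E = "\<integral>\<^sup>+ p. ennreal ((increment u p)\<^sup>2) \<partial>interaction_measure s \<Omega>"
    let ?P = "\<integral>\<^sup>+ x. ennreal ((u x)\<^sup>2) \<partial>exterior_measure \<Omega> \<kappa>"
    have [measurable]: "u \<in> borel_measurable (lebesgue_on (- \<Omega>))" by (rule measurable_restrict_space1[OF u])
    have "A n \<subseteq> - \<Omega>" by (auto simp: A_def)
    then have "(\<integral>\<^sup>+ x. ennreal ((u x)\<^sup>2) \<partial>lebesgue_on (A n))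
        = (\<integral>\<^sup>+ x. ennreal ((u x)\<^sup>2) * indicator (A n) x \<partial>lebesgue_on (- \<Omega>))"
      by (auto simp: nn_integral_restrict_space intro!: nn_integral_cong split: split_indicator)
    also have "\<dots> \<le> (\<integral>\<^sup>+ x. ennreal ?N * (ennreal (\<kappa> x) * ennreal ((u x)\<^sup>2)) \<partial>lebesgue_on (- \<Omega>))"
    proof (rule nn_integral_mono)
      fix x
      show "ennreal ((u x)\<^sup>2) * indicator (A n) x \<le> ennreal ?N * (ennreal (\<kappa> x) * ennreal ((u x)\<^sup>2))"
      proof (cases "x \<in> A n")
        case True
        then have "1 \<le> ?N * \<kappa> x" "0 \<le> \<kappa> x"
          by (auto simp: A_def field_simps intro: order_trans[of 0 "1 / ?N"])
        then have "1 * (u x)\<^sup>2 \<le> (?N * \<kappa> x) * (u x)\<^sup>2" by (intro mult_right_mono) auto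
        then show ?thesis
          using True \<open>0 \<le> \<kappa> x\<close> by (simp add: ennreal_mult[symmetric] mult.assoc del: of_nat_Suc)
      qed simp
    qed
    also have "\<dots> = ennreal ?N * ?P"
      by (simp add: nn_integral_cmult exterior_measure_def nn_integral_density del: of_nat_Suc)
    finally have ext: "(\<integral>\<^sup>+ x. ennreal ((u x)\<^sup>2) \<partial>lebesgue_on (A n)) \<le> ennreal ?N * ?P" .
    have "1 * ?E \<le> ennreal ?N * ?E"
      by (intro mult_right_mono) (auto simp flip: ennreal_1)
    then have "?E + (\<integral>\<^sup>+ x. ennreal ((u x)\<^sup>2) \<partial>lebesgue_on (A n)) \<le> ennreal ?N * ?E + ennreal ?N * ?P"
      using ext by (intro add_mono) auto
    then have "?E + (\<integral>\<^sup>+ x. ennreal ((u x)\<^sup>2) \<partial>lebesgue_on (A n))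
        \<le> ennreal ?N * robin_energy s \<Omega> \<kappa> u"
      by (simp add: robin_energy_def distrib_left)
    then have "ennreal R * (?E + (\<integral>\<^sup>+ x. ennreal ((u x)\<^sup>2) \<partial>lebesgue_on (A n)))
        \<le> ennreal R * (ennreal ?N * robin_energy s \<Omega> \<kappa> u)"
      by (intro mult_left_mono) auto
    from order_trans[OF le[OF u] this]
    have "(\<integral>\<^sup>+ x. ennreal ((u x)\<^sup>2) \<partial>lebesgue_on \<Omega>)
        \<le> ennreal (1 / a) * (ennreal R * (ennreal ?N * robin_energy s \<Omega> \<kappa> u))"
      using a by (intro ennreal_divide_left) auto
    also have "\<dots> = ennreal (1 / a * (R * ?N)) * robin_energy s \<Omega> \<kappa> u"
      using a R by (simp add: mult.assoc[symmetric] ennreal_mult[symmetric] del: of_nat_Suc)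
    finally show "(\<integral>\<^sup>+ x. ennreal ((u x)\<^sup>2) \<partial>lebesgue_on \<Omega>)
        \<le> ennreal (1 / a * (R * ?N)) * robin_energy s \<Omega> \<kappa> u" .
  qed
qed

text \<open>These are the constants of zero energy: only \<open>0\<close> for a genuine Robin condition, and all
  constants in the pure Neumann case.\<close>

definition null_constant :: "real \<Rightarrow> bool" where
  "null_constant c \<longleftrightarrow> (AE x in lebesgue_on (- \<Omega>). \<kappa> x * c = 0)"

lemma null_constant_iff: "null_constant c \<longleftrightarrow> c = 0 \<or> (AE x in lebesgue_on (- \<Omega>). \<kappa> x = 0)"
  by (cases "c = 0") (auto simp: null_constant_def)

lemma poincare:
  obtains K :: real where "0 \<le> K" "\<And>u. u \<in> borel_measurable lebesgue \<Longrightarrow>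
    \<exists>c. null_constant c \<and>
      (\<integral>\<^sup>+ x. ennreal ((u x - c)\<^sup>2) \<partial>lebesgue_on \<Omega>) \<le> ennreal K * robin_energy s \<Omega> \<kappa> u"
proof (cases "AE x in lebesgue_on (- \<Omega>). \<kappa> x = 0")
  case True
  then show ?thesis using poincare_neumann that by (metis null_constant_iff)
next
  case False
  obtain K where K: "0 \<le> K" "\<And>u. u \<in> borel_measurable lebesgue \<Longrightarrow>
    (\<integral>\<^sup>+ x. ennreal ((u x)\<^sup>2) \<partial>lebesgue_on \<Omega>) \<le> ennreal K * robin_energy s \<Omega> \<kappa> u"
    using poincare_robin[OF False] by blast
  show ?thesis
    by (rule that[OF K(1)], rule exI[of _ 0]) (use K(2) in \<open>auto simp: null_constant_iff\<close>)
qed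

lemma robin_energy_add_constant:
  assumes "null_constant c"
  shows "robin_energy s \<Omega> \<kappa> (\<lambda>x. u x + c) = robin_energy s \<Omega> \<kappa> u"
proof (cases "c = 0")
  case False
  with assms have "AE x in lebesgue_on (- \<Omega>). \<kappa> x = 0" by (simp add: null_constant_iff)
  then have "AE x in exterior_measure \<Omega> \<kappa>. False"
    unfolding exterior_measure_def
    by (subst AE_density) (auto elim: AE_mp)
  then have "(\<integral>\<^sup>+ x. ennreal ((u x + c)\<^sup>2) \<partial>exterior_measure \<Omega> \<kappa>)
      = (\<integral>\<^sup>+ x. ennreal ((u x)\<^sup>2) \<partial>exterior_measure \<Omega> \<kappa>)"
    by (intro nn_integral_cong_AE) auto
  then show ?thesis by (simp add: robin_energy_def increment_def)
qed simp

section \<open>Completeness of the energy space\<close>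

text \<open>Finite energy forces square integrability on \<open>\<Omega>\<close>: by the Poincare inequality \<open>u\<close>
  differs on \<open>\<Omega>\<close> from a constant by a square-integrable function, and \<open>\<Omega>\<close> has finite measure.\<close>

lemma W_space_iff:
  "u \<in> W_space s \<Omega> \<kappa> \<longleftrightarrow> u \<in> borel_measurable lebesgue \<and> robin_energy s \<Omega> \<kappa> u < \<infinity>"
proof
  assume "u \<in> W_space s \<Omega> \<kappa>"
  then show "u \<in> borel_measurable lebesgue \<and> robin_energy s \<Omega> \<kappa> u < \<infinity>"
    by (auto simp: W_space_def W_sqnorm_eq)
next
  assume *: "u \<in> borel_measurable lebesgue \<and> robin_energy s \<Omega> \<kappa> u < \<infinity>"
  then have [measurable]: "u \<in> borel_measurable lebesgue"
    and [measurable]: "u \<in> borel_measurable (lebesgue_on \<Omega>)" by (auto intro: measurable_restrict_space1)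
  obtain K c where "(\<integral>\<^sup>+ x. ennreal ((u x - c)\<^sup>2) \<partial>lebesgue_on \<Omega>)
      \<le> ennreal K * robin_energy s \<Omega> \<kappa> u"
    using poincare * by metis
  also have "\<dots> < \<infinity>" using * by (simp add: ennreal_mult_less_top)
  finally have fin: "(\<integral>\<^sup>+ x. ennreal ((u x - c)\<^sup>2) \<partial>lebesgue_on \<Omega>) < \<infinity>" .
  have "ennreal ((u x)\<^sup>2) \<le> 2 * ennreal ((u x - c)\<^sup>2) + ennreal (2 * c\<^sup>2)" for x
  proof -
    have "(u x)\<^sup>2 \<le> 2 * (u x - c)\<^sup>2 + 2 * c\<^sup>2"
      using sq_diff_le[of "u x - c" "- c"] by simp
    then have "ennreal ((u x)\<^sup>2) \<le> ennreal (2 * (u x - c)\<^sup>2 + 2 * c\<^sup>2)" by (rule ennreal_leI)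
    then show ?thesis by (simp add: ennreal_mult)
  qed
  then have "(\<integral>\<^sup>+ x. ennreal ((u x)\<^sup>2) \<partial>lebesgue_on \<Omega>)
      \<le> (\<integral>\<^sup>+ x. 2 * ennreal ((u x - c)\<^sup>2) + ennreal (2 * c\<^sup>2) \<partial>lebesgue_on \<Omega>)"
    by (intro nn_integral_mono)
  also have "\<dots> = 2 * (\<integral>\<^sup>+ x. ennreal ((u x - c)\<^sup>2) \<partial>lebesgue_on \<Omega>)
      + ennreal (2 * c\<^sup>2) * emeasure lebesgue \<Omega>"
    by (simp add: nn_integral_add nn_integral_cmult emeasure_restrict_space)
  also have "\<dots> < \<infinity>"
    using fin dom_emeasure by (simp add: ennreal_mult_less_top)
  finally show "u \<in> W_space s \<Omega> \<kappa>"
    using * by (simp add: W_space_def W_sqnorm_eq)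
qed

lemma W_space_iff_L2:
  "u \<in> W_space s \<Omega> \<kappa> \<longleftrightarrow> u \<in> borel_measurable lebesgue \<and>
     in_L2 (interaction_measure s \<Omega>) (increment u) \<and> in_L2 (exterior_measure \<Omega> \<kappa>) u"
  by (auto simp: W_space_iff in_L2_def robin_energy_def increment_measurable_interaction measurable_exterior)

lemma W_space_comb:
  assumes "u \<in> W_space s \<Omega> \<kappa>" "v \<in> W_space s \<Omega> \<kappa>"
  shows "(\<lambda>x. u x + t * v x) \<in> W_space s \<Omega> \<kappa>"
proof -
  have "increment (\<lambda>x. u x + t * v x) = (\<lambda>p. increment u p + t * increment v p)"
    by (auto simp: increment_def algebra_simps)
  then show ?thesis
    using assms by (auto simp: W_space_iff_L2 intro!: L2_comb)
qed

lemma AE_exterior_measureI: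
  assumes "AE x in lebesgue. P x"
  shows "AE x in exterior_measure \<Omega> \<kappa>. P x"
proof -
  have "AE x in lebesgue_on (- \<Omega>). P x"
    using assms by (simp add: AE_restrict_space_iff) (erule AE_mp, simp)
  then show ?thesis
    unfolding exterior_measure_def by (subst AE_density) (auto elim: AE_mp)
qed

lemma AE_interaction_measureI:
  assumes "AE x in lebesgue. P x"
  shows "AE p in interaction_measure s \<Omega>. P (fst p) \<and> P (snd p)"
  unfolding interaction_measure_def
  by (subst AE_density) (use AE_lebesgue_pairI[OF assms] in \<open>auto elim: AE_mp\<close>)

text \<open>The bound on the increments and the one on the exterior term pass to the limit separately,
  which costs the factor 2.\<close>

lemma robin_energy_limit:
  assumes w [measurable]: "\<And>m. w m \<in> borel_measurable lebesgue"
    and lim: "AE x in lebesgue. (\<lambda>m. w m x) \<longlonglongrightarrow> u x"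
    and le: "\<And>m. n \<le> m \<Longrightarrow> robin_energy s \<Omega> \<kappa> (\<lambda>x. w m x - w n x) \<le> L"
  shows "robin_energy s \<Omega> \<kappa> (\<lambda>x. u x - w n x) \<le> 2 * L"
proof -
  have lim': "AE x in lebesgue. (\<lambda>m. w m x - w n x) \<longlonglongrightarrow> u x - w n x"
    using lim by eventually_elim (intro tendsto_intros)
  have "(\<integral>\<^sup>+ p. ennreal ((increment (\<lambda>x. u x - w n x) p)\<^sup>2) \<partial>interaction_measure s \<Omega>) \<le> L"
  proof (rule nn_integral_sq_limit_le)
    show "AE p in interaction_measure s \<Omega>.
        (\<lambda>m. increment (\<lambda>x. w m x - w n x) p) \<longlonglongrightarrow> increment (\<lambda>x. u x - w n x) p"
      using AE_interaction_measureI[OF lim']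
      by eventually_elim (auto simp: increment_def intro!: tendsto_diff)
    show "(\<integral>\<^sup>+ p. ennreal ((increment (\<lambda>x. w m x - w n x) p)\<^sup>2) \<partial>interaction_measure s \<Omega>) \<le> L"
      if "n \<le> m" for m
      by (rule order_trans[OF _ le[OF that]]) (simp add: robin_energy_def)
  qed measurable
  moreover have "(\<integral>\<^sup>+ x. ennreal ((u x - w n x)\<^sup>2) \<partial>exterior_measure \<Omega> \<kappa>) \<le> L"
  proof (rule nn_integral_sq_limit_le)
    show "AE x in exterior_measure \<Omega> \<kappa>. (\<lambda>m. w m x - w n x) \<longlonglongrightarrow> u x - w n x"
      by (rule AE_exterior_measureI[OF lim'])
    show "(\<integral>\<^sup>+ x. ennreal ((w m x - w n x)\<^sup>2) \<partial>exterior_measure \<Omega> \<kappa>) \<le> L" if "n \<le> m" for m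
      by (rule order_trans[OF _ le[OF that]]) (simp add: robin_energy_def)
  qed (auto intro!: measurable_exterior)
  ultimately show ?thesis
    unfolding robin_energy_def mult_2 by (rule add_mono)
qed

lemma null_constant_sum:
  assumes "\<And>k. null_constant (c k)"
  shows "null_constant (\<Sum>k<n. c k)"
  using assms unfolding null_constant_iff by (metis sum.neutral)

text \<open>A Cauchy sequence in energy need not converge pointwise, because constants of zero energy may drift. From
  each difference of consecutive members a null constant \<open>c n\<close> is removed, which makes these
  differences small in \<open>L\<^sup>2\<close> of \<open>\<Omega>\<close> and hence of every ball. The corrected sequence
  \<open>w n = v n - (\<Sum>k<n. c k)\<close> has the same energies and converges almost everywhere.\<close>

lemma robin_energy_complete:
  assumes v: "\<And>n. v n \<in> W_space s \<Omega> \<kappa>" and L: "0 \<le> L"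
    and fast: "\<And>n m. n \<le> m \<Longrightarrow>
      robin_energy s \<Omega> \<kappa> (\<lambda>x. v m x - v n x) \<le> ennreal (L * (1/4) ^ n)"
  shows "\<exists>u\<in>W_space s \<Omega> \<kappa>. \<forall>n.
      robin_energy s \<Omega> \<kappa> (\<lambda>x. u x - v n x) \<le> 2 * ennreal (L * (1/4) ^ n)"
proof -
  have v_meas [measurable]: "\<And>n. v n \<in> borel_measurable lebesgue"
    using v by (auto simp: W_space_iff)
  obtain K where K: "0 \<le> K" and poinc: "\<And>u. u \<in> borel_measurable lebesgue \<Longrightarrow>
    \<exists>c. null_constant c \<and>
      (\<integral>\<^sup>+ x. ennreal ((u x - c)\<^sup>2) \<partial>lebesgue_on \<Omega>) \<le> ennreal K * robin_energy s \<Omega> \<kappa> u"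
    using poincare by blast
  have "\<exists>c. null_constant c \<and> (\<integral>\<^sup>+ x. ennreal (((v (Suc n) x - v n x) - c)\<^sup>2) \<partial>lebesgue_on \<Omega>)
      \<le> ennreal K * robin_energy s \<Omega> \<kappa> (\<lambda>x. v (Suc n) x - v n x)" for n
    by (rule poinc) measurable
  then obtain c where c: "\<And>n. null_constant (c n)"
    and c_le: "\<And>n. (\<integral>\<^sup>+ x. ennreal (((v (Suc n) x - v n x) - c n)\<^sup>2) \<partial>lebesgue_on \<Omega>)
      \<le> ennreal K * robin_energy s \<Omega> \<kappa> (\<lambda>x. v (Suc n) x - v n x)"
    by metis
  define w where "w n x = v n x - (\<Sum>k<n. c k)" for n x
  define d where "d n x = w (Suc n) x - w n x" for n x
  have d_eq: "d n x = (v (Suc n) x - v n x) - c n" for n x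
    by (simp add: d_def w_def)
  have w_meas [measurable]: "w n \<in> borel_measurable lebesgue" for n
    unfolding w_def by measurable
  have d_meas [measurable]: "d n \<in> borel_measurable lebesgue" for n
    unfolding d_def by measurable
  have neg: "null_constant (- b)" if "null_constant b" for b
    using that by (simp add: null_constant_iff)
  have d_dom: "(\<integral>\<^sup>+ x. ennreal ((d n x)\<^sup>2) \<partial>lebesgue_on \<Omega>) \<le> ennreal K * ennreal (L * (1/4) ^ n)"
    for n
    unfolding d_eq using order_trans[OF c_le mult_left_mono[OF fast[of n "Suc n"]]] by simp
  have d_energy: "robin_energy s \<Omega> \<kappa> (d n) \<le> ennreal (L * (1/4) ^ n)" for n
    using robin_energy_add_constant[OF neg[OF c], of "\<lambda>x. v (Suc n) x - v n x"] fast[of n "Suc n"]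
    by (simp add: d_eq[abs_def])
  have "AE x in lebesgue. x \<in> ball 0 (real R) \<longrightarrow> summable (\<lambda>n. d n x)" for R :: nat
  proof -
    have ball_sets: "ball 0 (real R) \<in> sets (lebesgue :: 'a measure)" by simp
    obtain K' where K': "0 \<le> K'" and loc: "\<And>u. u \<in> borel_measurable lebesgue \<Longrightarrow>
      (\<integral>\<^sup>+ x. ennreal ((u x)\<^sup>2) \<partial>lebesgue_on (ball 0 (real R)))
        \<le> ennreal K' * ((\<integral>\<^sup>+ x. ennreal ((u x)\<^sup>2) \<partial>lebesgue_on \<Omega>) + robin_energy s \<Omega> \<kappa> u)"
      using L2_local_control[OF ball_sets bounded_ball] by blast
    have "AE x in lebesgue_on (ball 0 (real R)). summable (\<lambda>n. d n x)"
    proof (rule L2_fast_AE_summable)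
      show "d n \<in> borel_measurable (lebesgue_on (ball 0 (real R)))" for n
        by (intro measurable_restrict_space1 d_meas)
      show "0 \<le> K' * (K * L + L)" using K K' L by simp
      fix n
      have "(\<integral>\<^sup>+ x. ennreal ((d n x)\<^sup>2) \<partial>lebesgue_on (ball 0 (real R)))
          \<le> ennreal K' * (ennreal K * ennreal (L * (1/4) ^ n) + ennreal (L * (1/4) ^ n))"
        by (rule order_trans[OF loc[OF d_meas]]) (intro mult_left_mono add_mono d_dom d_energy, simp)
      also have "\<dots> = ennreal (K' * (K * L + L) * (1/4) ^ n)"
        using K K' L by (simp add: ennreal_mult[symmetric] ennreal_plus[symmetric] algebra_simps
            del: ennreal_plus)
      finally show "(\<integral>\<^sup>+ x. ennreal ((d n x)\<^sup>2) \<partial>lebesgue_on (ball 0 (real R)))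
          \<le> ennreal (K' * (K * L + L) * (1/4) ^ n)" .
    qed
    then show ?thesis by (simp add: AE_restrict_space_iff)
  qed
  then have "AE x in lebesgue. \<forall>R::nat. x \<in> ball 0 (real R) \<longrightarrow> summable (\<lambda>n. d n x)"
    unfolding AE_all_countable by blast
  then have lim: "AE x in lebesgue. (\<lambda>n. w n x) \<longlonglongrightarrow> lim (\<lambda>n. w n x)"
  proof eventually_elim
    fix x assume *: "\<forall>R::nat. x \<in> ball 0 (real R) \<longrightarrow> summable (\<lambda>n. d n x)"
    obtain R :: nat where "norm x < real R" using reals_Archimedean2 by blast
    with * have "summable (\<lambda>n. d n x)" by auto
    then have "convergent (\<lambda>n. w 0 x + (\<Sum>k<n. d k x))"
      unfolding summable_iff_convergent by (rule convergent_add[OF convergent_const])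
    moreover have "w 0 x + (\<Sum>k<n. d k x) = w n x" for n
      unfolding d_def by (subst sum_lessThan_telescope) simp
    ultimately show "(\<lambda>n. w n x) \<longlonglongrightarrow> lim (\<lambda>n. w n x)"
      by (simp add: convergent_LIMSEQ_iff)
  qed
  define u where "u x = lim (\<lambda>n. w n x)" for x
  have u_meas [measurable]: "u \<in> borel_measurable lebesgue"
    unfolding u_def by measurable
  have shift: "null_constant (- (\<Sum>k<n. c k))" for n
    by (intro neg null_constant_sum c)
  have est: "robin_energy s \<Omega> \<kappa> (\<lambda>x. u x - v n x) \<le> 2 * ennreal (L * (1/4) ^ n)" for n
  proof -
    have "robin_energy s \<Omega> \<kappa> (\<lambda>x. w m x - w n x) \<le> ennreal (L * (1/4) ^ n)" if "n \<le> m" for m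
    proof -
      have "null_constant (- (\<Sum>k<m. c k) + (\<Sum>k<n. c k))"
        using shift[of m] null_constant_sum[of c n, OF c] by (auto simp: null_constant_iff)
      from robin_energy_add_constant[OF this, of "\<lambda>x. v m x - v n x"] fast[OF that]
      show ?thesis by (simp add: w_def algebra_simps)
    qed
    then have "robin_energy s \<Omega> \<kappa> (\<lambda>x. u x - w n x) \<le> 2 * ennreal (L * (1/4) ^ n)"
      using lim by (intro robin_energy_limit w_meas) (auto simp: u_def)
    then show ?thesis
      using robin_energy_add_constant[OF shift[of n], of "\<lambda>x. u x - w n x"]
      by (simp add: w_def algebra_simps)
  qed
  have "(\<lambda>x. u x - v 0 x) \<in> W_space s \<Omega> \<kappa>"
    using est[of 0] by (auto simp: W_space_iff ennreal_mult_less_top intro: le_less_trans)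
  from W_space_comb[OF this v[of 0], of 1] have "u \<in> W_space s \<Omega> \<kappa>" by simp
  with est show ?thesis by blast
qed

section \<open>The bilinear form and the functional\<close>

text \<open>The weak formulation is the case \<open>k = C_const DIM('a) s / 2\<close>.\<close>

definition robin_form :: "real \<Rightarrow> ('a \<Rightarrow> real) \<Rightarrow> ('a \<Rightarrow> real) \<Rightarrow> real" where
  "robin_form k u v = k * (LINT p|interaction_measure s \<Omega>. increment u p * increment v p)
     + (LINT x|exterior_measure \<Omega> \<kappa>. u x * v x)"

definition real_energy :: "('a \<Rightarrow> real) \<Rightarrow> real" where
  "real_energy u = (LINT p|interaction_measure s \<Omega>. (increment u p)\<^sup>2)
     + (LINT x|exterior_measure \<Omega> \<kappa>. (u x)\<^sup>2)"

lemma real_energy_nonneg: "0 \<le> real_energy u"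
  unfolding real_energy_def by (intro add_nonneg_nonneg integral_nonneg_AE) auto

lemma robin_energy_eq_real:
  assumes "u \<in> W_space s \<Omega> \<kappa>"
  shows "robin_energy s \<Omega> \<kappa> u = ennreal (real_energy u)"
proof -
  have "integrable (interaction_measure s \<Omega>) (\<lambda>p. (increment u p)\<^sup>2)"
    "integrable (exterior_measure \<Omega> \<kappa>) (\<lambda>x. (u x)\<^sup>2)"
    using assms by (auto simp: W_space_iff_L2 power2_eq_square intro!: L2_mult_integrable)
  then show ?thesis
    unfolding robin_energy_def real_energy_def
    by (subst ennreal_plus) (auto simp: nn_integral_eq_integral intro!: integral_nonneg_AE)
qed

lemma interaction_integral:
  assumes [measurable]: "u \<in> borel_measurable lebesgue" "v \<in> borel_measurable lebesgue"
  shows "(LINT (x, y):interaction_region \<Omega>|(lebesgue \<Otimes>\<^sub>M lebesgue).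
             (u x - u y) * (v x - v y) / norm (x - y) powr (real DIM('a) + 2 * s))
     = (LINT p|interaction_measure s \<Omega>. increment u p * increment v p)"
  unfolding interaction_measure_def set_lebesgue_integral_def
  by (subst integral_density)
     (auto intro!: Bochner_Integration.integral_cong simp: increment_def split: split_indicator)

lemma exterior_integral:
  assumes "u \<in> borel_measurable (lebesgue_on (- \<Omega>))" "v \<in> borel_measurable (lebesgue_on (- \<Omega>))"
  shows "(LINT x|lebesgue_on (- \<Omega>). \<kappa> x * u x * v x) = (LINT x|exterior_measure \<Omega> \<kappa>. u x * v x)"
  unfolding exterior_measure_def
  using assms \<kappa>_nonneg
  by (subst integral_density) (auto simp: mult.assoc)

lemma robin_form_sym: "robin_form k u v = robin_form k v u"
  by (simp add: robin_form_def mult.commute)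

lemma robin_form_linear:
  assumes "u \<in> W_space s \<Omega> \<kappa>" "v \<in> W_space s \<Omega> \<kappa>" "w \<in> W_space s \<Omega> \<kappa>"
  shows "robin_form k (\<lambda>x. u x + t * v x) w = robin_form k u w + t * robin_form k v w"
proof -
  have [simp]: "integrable (interaction_measure s \<Omega>) (\<lambda>p. increment u p * increment w p)"
    "integrable (interaction_measure s \<Omega>) (\<lambda>p. increment v p * increment w p)"
    "integrable (exterior_measure \<Omega> \<kappa>) (\<lambda>x. u x * w x)"
    "integrable (exterior_measure \<Omega> \<kappa>) (\<lambda>x. v x * w x)"
    using assms by (auto simp: W_space_iff_L2 intro!: L2_mult_integrable)
  have "(\<lambda>p. increment (\<lambda>x. u x + t * v x) p * increment w p)
      = (\<lambda>p. increment u p * increment w p + t * (increment v p * increment w p))"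
    "(\<lambda>x. (u x + t * v x) * w x) = (\<lambda>x. u x * w x + t * (v x * w x))"
    by (auto simp: increment_def algebra_simps)
  then show ?thesis
    unfolding robin_form_def by (simp add: algebra_simps)
qed

lemma robin_form_energy_bounds:
  assumes "0 < k"
  shows "min k 1 * real_energy u \<le> robin_form k u u"
    and "robin_form k u u \<le> max k 1 * real_energy u"
proof -
  let ?e1 = "LINT p|interaction_measure s \<Omega>. (increment u p)\<^sup>2"
  let ?e2 = "LINT x|exterior_measure \<Omega> \<kappa>. (u x)\<^sup>2"
  have eq: "robin_form k u u = k * ?e1 + ?e2"
    by (simp add: robin_form_def power2_eq_square)
  have "0 \<le> ?e1" "0 \<le> ?e2" by (auto intro!: integral_nonneg_AE)
  then have "min k 1 * ?e1 + min k 1 * ?e2 \<le> k * ?e1 + 1 * ?e2"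
    "k * ?e1 + 1 * ?e2 \<le> max k 1 * ?e1 + max k 1 * ?e2"
    by (intro add_mono mult_right_mono; simp)+
  then show "min k 1 * real_energy u \<le> robin_form k u u"
    "robin_form k u u \<le> max k 1 * real_energy u"
    by (simp_all add: eq real_energy_def distrib_left)
qed

lemma W_space_diff:
  assumes "u \<in> W_space s \<Omega> \<kappa>" "v \<in> W_space s \<Omega> \<kappa>"
  shows "(\<lambda>x. u x - v x) \<in> W_space s \<Omega> \<kappa>"
  using W_space_comb[OF assms, of "-1"] by simp

lemma const_in_W_space: "(\<lambda>x. c) \<in> W_space s \<Omega> \<kappa>"
proof -
  have "(\<integral>\<^sup>+ x. ennreal (c\<^sup>2) \<partial>exterior_measure \<Omega> \<kappa>) = ennreal (c\<^sup>2) * (\<integral>\<^sup>+ x. ennreal (\<kappa> x) \<partial>lebesgue_on (- \<Omega>))"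
    unfolding exterior_measure_def
    by (subst nn_integral_density) (auto simp: nn_integral_multc mult.commute)
  also have "(\<integral>\<^sup>+ x. ennreal (\<kappa> x) \<partial>lebesgue_on (- \<Omega>)) = ennreal (LINT x|lebesgue_on (- \<Omega>). \<kappa> x)"
    by (rule nn_integral_eq_integral[OF \<kappa>_int \<kappa>_nonneg])
  finally show ?thesis
    by (simp add: W_space_iff robin_energy_def increment_def ennreal_mult_less_top)
qed

lemma robin_form_complete:
  assumes "0 < k" and v: "\<And>n. v n \<in> W_space s \<Omega> \<kappa>"
    and fast: "\<And>n m. n \<le> m \<Longrightarrow>
      robin_form k (\<lambda>x. v m x - v n x) (\<lambda>x. v m x - v n x) \<le> (1/4) ^ n"
  shows "\<exists>u\<in>W_space s \<Omega> \<kappa>.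
    (\<lambda>n. robin_form k (\<lambda>x. u x - v n x) (\<lambda>x. u x - v n x)) \<longlonglongrightarrow> 0"
proof -
  define L where "L = 1 / min k 1"
  have L: "0 \<le> L" using \<open>0 < k\<close> by (simp add: L_def)
  have "robin_energy s \<Omega> \<kappa> (\<lambda>x. v m x - v n x) \<le> ennreal (L * (1/4) ^ n)" if "n \<le> m" for n m
  proof -
    have "min k 1 * real_energy (\<lambda>x. v m x - v n x) \<le> (1/4) ^ n"
      using robin_form_energy_bounds(1)[OF \<open>0 < k\<close>] fast[OF that] by (rule order_trans)
    then have "real_energy (\<lambda>x. v m x - v n x) \<le> L * (1/4) ^ n"
      using \<open>0 < k\<close> by (simp add: L_def pos_le_divide_eq mult.commute)
    then show ?thesis
      by (subst robin_energy_eq_real) (auto intro!: W_space_diff v ennreal_leI)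
  qed
  from robin_energy_complete[OF v L this] obtain u where u: "u \<in> W_space s \<Omega> \<kappa>"
    and le: "\<And>n. robin_energy s \<Omega> \<kappa> (\<lambda>x. u x - v n x) \<le> 2 * ennreal (L * (1/4) ^ n)"
    by blast
  have "(\<lambda>n. robin_form k (\<lambda>x. u x - v n x) (\<lambda>x. u x - v n x)) \<longlonglongrightarrow> 0"
  proof (rule tendsto_sandwich)
    show "\<forall>\<^sub>F n in sequentially. 0 \<le> robin_form k (\<lambda>x. u x - v n x) (\<lambda>x. u x - v n x)"
    proof (rule always_eventually, rule allI)
      fix n
      have "0 \<le> min k 1 * real_energy (\<lambda>x. u x - v n x)"
        using \<open>0 < k\<close> real_energy_nonneg by simp
      then show "0 \<le> robin_form k (\<lambda>x. u x - v n x) (\<lambda>x. u x - v n x)"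
        using robin_form_energy_bounds(1)[OF \<open>0 < k\<close>] by (rule order_trans)
    qed
    show "\<forall>\<^sub>F n in sequentially. robin_form k (\<lambda>x. u x - v n x) (\<lambda>x. u x - v n x)
        \<le> max k 1 * (2 * (L * (1/4) ^ n))"
    proof (rule always_eventually, rule allI)
      fix n
      have "ennreal (real_energy (\<lambda>x. u x - v n x)) \<le> ennreal (2 * (L * (1/4) ^ n))"
        using le[of n] robin_energy_eq_real[OF W_space_diff[OF u v]] L by (simp add: ennreal_mult)
      then have "real_energy (\<lambda>x. u x - v n x) \<le> 2 * (L * (1/4) ^ n)"
        using L by (subst (asm) ennreal_le_iff) auto
      then have "max k 1 * real_energy (\<lambda>x. u x - v n x) \<le> max k 1 * (2 * (L * (1/4) ^ n))"
        by (rule mult_left_mono) simp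
      with robin_form_energy_bounds(2)[OF \<open>0 < k\<close>]
      show "robin_form k (\<lambda>x. u x - v n x) (\<lambda>x. u x - v n x) \<le> max k 1 * (2 * (L * (1/4) ^ n))"
        by (rule order_trans)
    qed
    have "(\<lambda>n. max k 1 * (2 * (L * (1/4) ^ n))) \<longlonglongrightarrow> max k 1 * (2 * (L * 0))"
      by (intro tendsto_intros LIMSEQ_power_zero) simp
    then show "(\<lambda>n. max k 1 * (2 * (L * (1/4) ^ n))) \<longlonglongrightarrow> 0" by simp
  qed simp
  with u show ?thesis by blast
qed

text \<open>The functional \<open>f\<close> is bounded for the full norm, yet the energy of \<open>v\<close> alone suffices: \<open>f\<close> does
  not change when \<open>v\<close> is replaced by \<open>v - c\<close> for a null constant \<open>c\<close>, and for a good \<open>c\<close> the full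
  norm of \<open>v - c\<close> is bounded by the energy. This is where the compatibility condition of the
  Neumann case is used.\<close>

lemma dual_energy_bound:
  assumes f: "f \<in> W_dual s \<Omega> \<kappa>"
    and compat: "(AE x in lebesgue_on (- \<Omega>). \<kappa> x = 0) \<longrightarrow> f (\<lambda>x. 1) = 0"
  obtains D where "\<And>v. v \<in> W_space s \<Omega> \<kappa> \<Longrightarrow> f v \<le> D * sqrt (real_energy v)"
proof -
  have add: "f (\<lambda>x. u x + v x) = f u + f v" if "u \<in> W_space s \<Omega> \<kappa>" "v \<in> W_space s \<Omega> \<kappa>" for u v
    using f that by (auto simp: W_dual_def)
  have scale: "f (\<lambda>x. c * u x) = c * f u" if "u \<in> W_space s \<Omega> \<kappa>" for c u
    using f that by (auto simp: W_dual_def)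
  have "\<exists>C. \<forall>u\<in>W_space s \<Omega> \<kappa>. \<bar>f u\<bar> \<le> C * W_norm s \<Omega> \<kappa> u"
    using f by (simp add: W_dual_def)
  then obtain C where C: "\<And>u. u \<in> W_space s \<Omega> \<kappa> \<Longrightarrow> \<bar>f u\<bar> \<le> C * W_norm s \<Omega> \<kappa> u"
    by blast
  have f_const: "f (\<lambda>x. c) = 0" if "null_constant c" for c
    using scale[OF const_in_W_space[of 1], of c] compat that by (auto simp: null_constant_iff)
  obtain K where K: "0 \<le> K" and poinc: "\<And>u. u \<in> borel_measurable lebesgue \<Longrightarrow>
    \<exists>c. null_constant c \<and>
      (\<integral>\<^sup>+ x. ennreal ((u x - c)\<^sup>2) \<partial>lebesgue_on \<Omega>) \<le> ennreal K * robin_energy s \<Omega> \<kappa> u"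
    using poincare by blast
  show ?thesis
  proof (rule that)
    fix v assume v: "v \<in> W_space s \<Omega> \<kappa>"
    then have v_meas [measurable]: "v \<in> borel_measurable lebesgue" by (simp add: W_space_iff)
    obtain c where c: "null_constant c"
      "(\<integral>\<^sup>+ x. ennreal ((v x - c)\<^sup>2) \<partial>lebesgue_on \<Omega>) \<le> ennreal K * robin_energy s \<Omega> \<kappa> v"
      using poinc[OF v_meas] by blast
    let ?g = "\<lambda>x. v x - c"
    have g: "?g \<in> W_space s \<Omega> \<kappa>" by (intro W_space_diff v const_in_W_space)
    have "null_constant (- c)" using c(1) by (simp add: null_constant_iff)
    from robin_energy_add_constant[OF this, of v]
    have g_energy: "robin_energy s \<Omega> \<kappa> ?g = robin_energy s \<Omega> \<kappa> v" by simp
    have "W_sqnorm s \<Omega> \<kappa> ?g \<le> ennreal K * robin_energy s \<Omega> \<kappa> v + robin_energy s \<Omega> \<kappa> v"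
      using c(2) by (simp add: W_sqnorm_eq g_energy add_right_mono)
    also have "\<dots> = ennreal ((K + 1) * real_energy v)"
      using K real_energy_nonneg[of v]
      by (simp add: robin_energy_eq_real[OF v] ennreal_mult distrib_right)
    finally have "enn2real (W_sqnorm s \<Omega> \<kappa> ?g) \<le> (K + 1) * real_energy v"
      using K real_energy_nonneg[of v] by (intro enn2real_leI) auto
    then have "W_norm s \<Omega> \<kappa> ?g \<le> sqrt (K + 1) * sqrt (real_energy v)"
      unfolding W_norm_def real_sqrt_mult[symmetric] by (rule real_sqrt_le_mono)
    then have "\<bar>C\<bar> * W_norm s \<Omega> \<kappa> ?g \<le> \<bar>C\<bar> * (sqrt (K + 1) * sqrt (real_energy v))"
      by (intro mult_left_mono) auto
    moreover have "C * W_norm s \<Omega> \<kappa> ?g \<le> \<bar>C\<bar> * W_norm s \<Omega> \<kappa> ?g"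
      by (intro mult_right_mono) (auto simp: W_norm_def)
    moreover have "f v = f ?g"
      using add[OF g const_in_W_space[of c]] f_const[OF c(1)] by simp
    ultimately show "f v \<le> (\<bar>C\<bar> * sqrt (K + 1)) * sqrt (real_energy v)"
      using C[OF g] by simp
  qed
qed

text \<open>Half of the coercivity constant of the form, \<open>\<delta>\<close>, absorbs each of the two parts of \<open>F\<close> by Young's
  inequality, so the functional is bounded below.\<close>

lemma robin_weak_solution_exists:
  assumes "s < 1" and z: "in_L2 (exterior_measure \<Omega> \<kappa>) z" and f: "f \<in> W_dual s \<Omega> \<kappa>"
    and compat: "(AE x in lebesgue_on (- \<Omega>). \<kappa> x = 0) \<longrightarrow> f (\<lambda>x. 1) = 0"
  shows "\<exists>u. robin_weak_solution s \<Omega> \<kappa> f z u"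
proof -
  define k where "k = C_const DIM('a) s / 2"
  have k: "0 < k" using C_const_pos[OF s_pos \<open>s < 1\<close>] by (simp add: k_def)
  define F where "F v = f v + (LINT x|exterior_measure \<Omega> \<kappa>. z x * v x)" for v
  have zv [simp]: "integrable (exterior_measure \<Omega> \<kappa>) (\<lambda>x. z x * v x)" if "v \<in> W_space s \<Omega> \<kappa>" for v
    using that by (intro L2_mult_integrable z) (simp add: W_space_iff_L2)
  obtain D where D: "\<And>v. v \<in> W_space s \<Omega> \<kappa> \<Longrightarrow> f v \<le> D * sqrt (real_energy v)"
    using dual_energy_bound[OF f compat] by blast
  define \<delta> where "\<delta> = min k 1 / 2"
  have \<delta>: "0 < \<delta>" using k by (simp add: \<delta>_def)
  define B where "B = D\<^sup>2 / \<delta> + (LINT x|exterior_measure \<Omega> \<kappa>. (z x)\<^sup>2) / \<delta>"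
  have "\<exists>u\<in>W_space s \<Omega> \<kappa>. \<forall>v\<in>W_space s \<Omega> \<kappa>. robin_form k u v = F v"
  proof (rule quadratic_functional_minimizer)
    show "W_space s \<Omega> \<kappa> \<noteq> {}" using const_in_W_space by blast
    show "robin_form k u v = robin_form k v u" for u v by (rule robin_form_sym)
    show "F (\<lambda>x. u x + t * v x) = F u + t * F v"
      if u: "u \<in> W_space s \<Omega> \<kappa>" and v: "v \<in> W_space s \<Omega> \<kappa>" for u v t
    proof -
      have "(\<lambda>x. t * v x) \<in> W_space s \<Omega> \<kappa>"
        using W_space_comb[OF const_in_W_space[of 0] v, of t] by simp
      then have "f (\<lambda>x. u x + t * v x) = f u + t * f v"
        using f u v by (simp add: W_dual_def)
      moreover have "(\<lambda>x. z x * (u x + t * v x)) = (\<lambda>x. z x * u x + t * (z x * v x))"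
        by (auto simp: algebra_simps)
      ultimately show ?thesis
        using zv[OF u] zv[OF v] by (simp add: F_def distrib_left)
    qed
    show "- B \<le> robin_form k v v - 2 * F v" if v: "v \<in> W_space s \<Omega> \<kappa>" for v
    proof -
      let ?E = "real_energy v"
      have v2: "integrable (exterior_measure \<Omega> \<kappa>) (\<lambda>x. (v x)\<^sup>2)"
        and z2: "integrable (exterior_measure \<Omega> \<kappa>) (\<lambda>x. (z x)\<^sup>2)"
        using v z by (auto simp: W_space_iff_L2 power2_eq_square intro!: L2_mult_integrable)
      have "2 * f v \<le> 2 * (D * sqrt ?E)" using D[OF v] by simp
      also have "\<dots> \<le> D\<^sup>2 / \<delta> + \<delta> * ?E"
        using young_2[OF \<delta>, of D "sqrt ?E"] real_energy_nonneg[of v] by simp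
      finally have f_le: "2 * f v \<le> D\<^sup>2 / \<delta> + \<delta> * ?E" .
      have "(LINT x|exterior_measure \<Omega> \<kappa>. 2 * (z x * v x))
          \<le> (LINT x|exterior_measure \<Omega> \<kappa>. (z x)\<^sup>2 / \<delta> + \<delta> * (v x)\<^sup>2)"
        using v v2 z2 by (intro integral_mono young_2 \<delta>) auto
      also have "\<dots> = (LINT x|exterior_measure \<Omega> \<kappa>. (z x)\<^sup>2) / \<delta>
          + \<delta> * (LINT x|exterior_measure \<Omega> \<kappa>. (v x)\<^sup>2)"
        using v2 z2 by simp
      also have "\<dots> \<le> (LINT x|exterior_measure \<Omega> \<kappa>. (z x)\<^sup>2) / \<delta> + \<delta> * ?E"
        using \<delta> by (intro add_left_mono mult_left_mono)
          (auto simp: real_energy_def intro!: integral_nonneg_AE)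
      finally have z_le: "2 * (LINT x|exterior_measure \<Omega> \<kappa>. z x * v x)
          \<le> (LINT x|exterior_measure \<Omega> \<kappa>. (z x)\<^sup>2) / \<delta> + \<delta> * ?E"
        by simp
      have "2 * \<delta> * ?E \<le> robin_form k v v"
        using robin_form_energy_bounds(1)[OF k, of v] by (simp add: \<delta>_def)
      then show ?thesis
        using f_le z_le by (simp add: F_def B_def)
    qed
  qed (auto intro: W_space_comb robin_form_linear robin_form_complete[OF k])
  then obtain u where u: "u \<in> W_space s \<Omega> \<kappa>"
    and eq: "\<And>v. v \<in> W_space s \<Omega> \<kappa> \<Longrightarrow> robin_form k u v = F v" by blast
  have z_meas: "z \<in> borel_measurable (lebesgue_on (- \<Omega>))"
    using z by (simp add: in_L2_def exterior_measure_def)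
  have "robin_weak_solution s \<Omega> \<kappa> f z u"
    unfolding robin_weak_solution_def
  proof (intro conjI ballI u)
    fix v assume v: "v \<in> W_space s \<Omega> \<kappa>"
    have meas: "u \<in> borel_measurable lebesgue" "v \<in> borel_measurable lebesgue"
      using u v by (auto simp: W_space_iff)
    show "C_const DIM('a) s / 2 *
          (LINT (x, y):interaction_region \<Omega>|(lebesgue \<Otimes>\<^sub>M lebesgue).
             (u x - u y) * (v x - v y) / norm (x - y) powr (real DIM('a) + 2 * s))
        + (LINT x|lebesgue_on (- \<Omega>). \<kappa> x * u x * v x)
        = f v + (LINT x|lebesgue_on (- \<Omega>). \<kappa> x * z x * v x)"
      using eq[OF v]
      unfolding interaction_integral[OF meas]
        exterior_integral[OF measurable_restrict_space1[OF meas(1)] measurable_restrict_space1[OF meas(2)]]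
        exterior_integral[OF z_meas measurable_restrict_space1[OF meas(2)]]
      by (simp add: robin_form_def F_def k_def)
  qed
  then show ?thesis by blast
qed

end

theorem proposition3p8:
  fixes \<Omega> :: "'a::euclidean_space set" and s :: real and \<kappa> z :: "'a \<Rightarrow> real"
    and f :: "('a \<Rightarrow> real) \<Rightarrow> real"
  assumes "0 < s" and "s < 1"
    and "bounded_lipschitz_domain \<Omega>"
    and "integrable (lebesgue_on (- \<Omega>)) \<kappa>"
    and "\<exists>C. AE x in lebesgue_on (- \<Omega>). \<bar>\<kappa> x\<bar> \<le> C"
    and "AE x in lebesgue_on (- \<Omega>). 0 \<le> \<kappa> x"
    and "in_L2 (exterior_measure \<Omega> \<kappa>) z"
    and "f \<in> W_dual s \<Omega> \<kappa>"
    and "(AE x in lebesgue_on (- \<Omega>). \<kappa> x = 0) \<longrightarrow> f (\<lambda>x. 1) = 0"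
  shows "\<exists>u. robin_weak_solution s \<Omega> \<kappa> f z u"
proof -
  interpret robin_data s \<Omega> \<kappa>
    using assms by unfold_locales (auto simp: bounded_lipschitz_domain_def)
  show ?thesis using assms by (intro robin_weak_solution_exists) auto
qed

end
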